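(* Let $\Sigma$ be a $d\times d$ positive-definite matrix with $(2\pi)^{d/2}\sqrt{\det\Sigma}=1$, and let $X$ be the Gaussian DPP on $\mathbb{R}^d$ with scattering matrix $\Sigma$. For $R>0$ let $N$ be the (random) number of points of $X$ lying in the closed Euclidean ball $B(R)$ of radius $R$ centred at the origin, and let $n=\mathbb{E}[N]$. Then $$n=|B(R)|=|B(1)|R^d,$$ where $|B(t)|$ denotes the Lebesgue volume of the Euclidean ball of radius $t$, and for every $\varepsilon>0$, $$\mathbb{P}\Big[\Big|\frac{N}{n}-1\Big|\ge\varepsilon\Big]\le 2\exp\Big(-\frac{3\varepsilon^2}{6+2\varepsilon}|B(R)|\Big).$$
   Context: The Gaussian DPP with scattering matrix $\Sigma$ (a $d\times d$ positive-definite matrix) is the stationary determinantal point process on $\mathbb{R}^d$ with background measure Lebesgue measure and kernel $K(x,y)=\frac{1}{(2\pi)^{d/2}\sqrt{\det\Sigma}}\exp(-\frac12(x-y)^\top\Sigma^{-1}(x-y))$; i.e. its $k$-point correlation functions are $\rho_k(x_1,\dots,x_k)=\det[K(x_i,x_j)]_{i,j=1}^k$. Under the normalization $(2\pi)^{d/2}\sqrt{\det\Sigma}=1$ the kernel is $K(x,y)=\exp(-\frac12(x-y)^\top\Sigma^{-1}(x-y))$ and the mean density of points is $1$. *)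

theory Defs
  imports "HOL-Probability.Probability" "HOL-Combinatorics.Permutations"
begin

definition pos_def_matrix :: "real^'n^'n \<Rightarrow> bool" where
  "pos_def_matrix S \<longleftrightarrow> transpose S = S \<and> (\<forall>x. x \<noteq> 0 \<longrightarrow> x \<bullet> (S *v x) > 0)"

definition gauss_kernel :: "real^'n^'n \<Rightarrow> real^'n \<Rightarrow> real^'n \<Rightarrow> real" where
  "gauss_kernel S x y =
     exp (-(1/2) * ((x - y) \<bullet> (matrix_inv S *v (x - y))))
     / ((2 * pi) powr (real CARD('n) / 2) * sqrt (det S))"

definition kernel_det :: "('a \<Rightarrow> 'a \<Rightarrow> real) \<Rightarrow> nat \<Rightarrow> (nat \<Rightarrow> 'a) \<Rightarrow> real" where
  "kernel_det K k x = (\<Sum>p | p permutes {..<k}. of_int (sign p) * (\<Prod>i<k. K (x i) (x (p i))))"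

definition pcount :: "('b \<Rightarrow> 'a set) \<Rightarrow> 'a set \<Rightarrow> 'b \<Rightarrow> nat" where
  "pcount X A \<omega> = card (X \<omega> \<inter> A)"

definition point_process :: "'b measure \<Rightarrow> ('b \<Rightarrow> 'a::euclidean_space set) \<Rightarrow> bool" where
  "point_process M X \<longleftrightarrow> prob_space M \<and>
     (\<forall>\<omega>\<in>space M. \<forall>A. bounded A \<longrightarrow> finite (X \<omega> \<inter> A)) \<and>
     (\<forall>A\<in>sets borel. pcount X A \<in> measurable M (count_space UNIV))"

definition has_correlation_functions ::
  "'b measure \<Rightarrow> ('b \<Rightarrow> 'a::euclidean_space set) \<Rightarrow> (nat \<Rightarrow> (nat \<Rightarrow> 'a) \<Rightarrow> real) \<Rightarrow> bool" where
  "has_correlation_functions M X \<rho> \<longleftrightarrow>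
     (\<forall>k A. k \<ge> 1 \<longrightarrow> (\<forall>i<k. A i \<in> sets borel \<and> bounded (A i)) \<longrightarrow>
        (\<forall>i<k. \<forall>j<k. i \<noteq> j \<longrightarrow> A i \<inter> A j = {}) \<longrightarrow>
        (\<integral>\<^sup>+ \<omega>. (\<Prod>i<k. ennreal (real (pcount X (A i) \<omega>))) \<partial>M) =
        (\<integral>\<^sup>+ x. ennreal ((\<Prod>i<k. indicator (A i) (x i)) * \<rho> k x)
            \<partial>(PiM {..<k} (\<lambda>_. lborel))))"

definition is_DPP :: "'b measure \<Rightarrow> ('b \<Rightarrow> 'a::euclidean_space set) \<Rightarrow> ('a \<Rightarrow> 'a \<Rightarrow> real) \<Rightarrow> bool" where
  "is_DPP M X K \<longleftrightarrow> point_process M X \<and> has_correlation_functions M X (kernel_det K)"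

end

theory Submission
  imports Defs
begin

text \<open>
  Write \<open>N\<close> for the number of points in a compact set \<open>B\<close> and \<open>\<Lambda>(B)\<close> for the integral of \<open>K(x, x)\<close>
  over \<open>B\<close>. Everything rests on \<open>E (1 + z)^N \<le> exp (z \<Lambda>(B))\<close> for all \<open>z > -1\<close>, the bound
  satisfied by a Poisson variable; Bernstein's inequality then follows by Chernoff's method.

  Cut \<open>B\<close> into small cells \<open>C\<close> of volume \<open>|C|\<close> containing \<open>N\<^sub>C\<close> points. Expanding \<open>\<Prod>(1 + z N\<^sub>C)\<close>
  over sets of distinct cells and inserting the correlation functions gives the exact identity
  \<open>E \<Prod>(1 + z N\<^sub>C) = E det (I + z L(x))\<close>, where \<open>L(x)\<^sub>C\<^sub>D = sqrt (|C| |D|) K(x\<^sub>C, x\<^sub>D)\<close> and the \<open>x\<^sub>C\<close>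
  are independent and uniform in their cells. As the integrals of \<open>|K(x, \<cdot>)|\<close> are at most one, the
  Schur test bounds the eigenvalues of \<open>L(x)\<close> by a constant that tends to one as the cells shrink,
  so \<open>I + z L(x)\<close> is positive semidefinite for fine cells. By Hadamard's inequality its determinant
  is at most the product of its diagonal, whose mean is \<open>\<Prod>(1 + z \<Lambda>(C)) \<le> exp (z \<Lambda>(B))\<close>. Finally
  \<open>\<Prod>(1 + z N\<^sub>C)\<close> tends to \<open>(1 + z)^N\<close> and is dominated by \<open>(1 + |z|)^N\<close>, which is integrable by
  Fatou's lemma.
\<close>

section \<open>Determinants over finite index sets\<close>

definition det_on :: "'i set \<Rightarrow> ('i \<Rightarrow> 'i \<Rightarrow> 'r::comm_ring_1) \<Rightarrow> 'r" where
  "det_on I A = (\<Sum>p | p permutes I. of_int (sign p) * (\<Prod>i\<in>I. A i (p i)))"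

definition schur_complement :: "'i \<Rightarrow> ('i \<Rightarrow> 'i \<Rightarrow> 'r::field) \<Rightarrow> 'i \<Rightarrow> 'i \<Rightarrow> 'r" where
  "schur_complement t A i j = A i j - A i t / A t t * A t j"

lemma det_on_empty [simp]: "det_on {} A = 1"
  by (simp add: det_on_def)

lemma det_on_singleton [simp]: "det_on {i} A = A i i"
  by (simp add: det_on_def)

lemma det_on_cong:
  assumes "\<And>i j. i \<in> I \<Longrightarrow> j \<in> I \<Longrightarrow> A i j = B i j"
  shows "det_on I A = det_on I B"
  unfolding det_on_def
  by (intro sum.cong refl arg_cong2[where f = "(*)"] prod.cong)
     (auto intro!: assms simp: permutes_in_image)

lemma det_on_identical_rows:
  fixes A :: "'i \<Rightarrow> 'i \<Rightarrow> 'r::field_char_0"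
  assumes "finite I" "i \<in> I" "j \<in> I" "i \<noteq> j" and rows: "\<And>k. k \<in> I \<Longrightarrow> A i k = A j k"
  shows "det_on I A = 0"
proof -
  define \<tau> where "\<tau> = Transposition.transpose i j"
  have \<tau>: "\<tau> permutes I"
    unfolding \<tau>_def using assms(2,3) by (rule permutes_swap_id)
  have "det_on I A = (\<Sum>p | p permutes I. of_int (sign (p \<circ> \<tau>)) * (\<Prod>l\<in>I. A l ((p \<circ> \<tau>) l)))"
    unfolding det_on_def by (rule sum_permutations_compose_right[OF \<tau>])
  also have "\<dots> = (\<Sum>p | p permutes I. - (of_int (sign p) * (\<Prod>l\<in>I. A l (p l))))"
  proof (rule sum.cong[OF refl])
    fix p assume "p \<in> {p. p permutes I}"
    then have p: "p permutes I" by simp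
    have "sign (p \<circ> \<tau>) = sign p * sign \<tau>"
      using p \<tau> assms(1) by (intro sign_compose) (auto simp: permutation_permutes)
    then have sign: "sign (p \<circ> \<tau>) = - sign p"
      using assms(4) by (simp add: \<tau>_def sign_swap_id)
    have "(\<Prod>l\<in>I. A l ((p \<circ> \<tau>) l)) = (\<Prod>l\<in>I. A (\<tau> l) (p l))"
      by (subst prod.permute[OF \<tau>]) (simp add: o_def \<tau>_def)
    also have "\<dots> = (\<Prod>l\<in>I. A l (p l))"
      using rows permutes_in_image[OF p]
      by (intro prod.cong refl) (auto simp: \<tau>_def Transposition.transpose_def)
    finally show "of_int (sign (p \<circ> \<tau>)) * (\<Prod>l\<in>I. A l ((p \<circ> \<tau>) l)) =
        - (of_int (sign p) * (\<Prod>l\<in>I. A l (p l)))"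
      using sign by simp
  qed
  also have "\<dots> = - det_on I A"
    by (simp add: det_on_def sum_negf)
  finally have "2 * det_on I A = 0"
    by (simp only: mult_2 add_eq_0_iff)
  then show ?thesis by simp
qed

lemma det_on_row_operation:
  fixes A :: "'i \<Rightarrow> 'i \<Rightarrow> 'r::field_char_0"
  assumes "finite I" "i \<in> I" "t \<in> I" "i \<noteq> t"
  shows "det_on I (A(i := \<lambda>k. A i k - c * A t k)) = det_on I A"
proof -
  have expand_row: "(\<Prod>l\<in>I. (A(i := r)) l (p l)) = r (p i) * (\<Prod>l\<in>I-{i}. A l (p l))" for r p
    by (subst prod.remove[OF assms(1,2)]) (auto intro!: prod.cong)
  have "det_on I (A(i := \<lambda>k. A i k - c * A t k)) =
      det_on I (A(i := A i)) - c * det_on I (A(i := A t))"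
    unfolding det_on_def expand_row sum_distrib_left sum_subtractf[symmetric]
    by (intro sum.cong refl) (simp add: algebra_simps)
  also have "det_on I (A(i := A t)) = 0"
    using assms by (intro det_on_identical_rows[of I i t]) auto
  finally show ?thesis by (simp only: fun_upd_triv mult_zero_right diff_zero)
qed

lemma det_on_row_operations:
  fixes A :: "'i \<Rightarrow> 'i \<Rightarrow> 'r::field_char_0"
  assumes "finite I" "t \<in> I" "U \<subseteq> I - {t}"
  shows "det_on I (\<lambda>i k. if i \<in> U then A i k - c i * A t k else A i k) = det_on I A"
proof -
  have "finite U" using assms finite_subset by blast
  then show ?thesis using assms(3)
  proof (induction U)
    case (insert u U)
    let ?B = "\<lambda>i k. if i \<in> U then A i k - c i * A t k else A i k"
    have "(\<lambda>i k. if i \<in> insert u U then A i k - c i * A t k else A i k) =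
        ?B(u := \<lambda>k. ?B u k - c u * ?B t k)"
      using insert by (auto simp: fun_eq_iff)
    moreover have "det_on I (?B(u := \<lambda>k. ?B u k - c u * ?B t k)) = det_on I ?B"
      using insert assms by (intro det_on_row_operation) auto
    ultimately show ?case using insert by simp
  qed simp
qed

lemma det_on_insert_zero_column:
  assumes "finite T" "t \<notin> T" "\<And>i. i \<in> T \<Longrightarrow> A i t = 0"
  shows "det_on (insert t T) A = A t t * det_on T A"
proof -
  have "det_on (insert t T) A =
      (\<Sum>p | p permutes T. of_int (sign p) * (\<Prod>i\<in>insert t T. A i (p i)))"
    unfolding det_on_def
  proof (rule sum.mono_neutral_right)
    show "finite {p. p permutes insert t T}" using assms by (simp add: finite_permutations)
    show "{p. p permutes T} \<subseteq> {p. p permutes insert t T}"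
      by (auto intro: permutes_subset)
    show "\<forall>p\<in>{p. p permutes insert t T} - {p. p permutes T}.
        of_int (sign p) * (\<Prod>i\<in>insert t T. A i (p i)) = 0"
    proof
      fix p assume "p \<in> {p. p permutes insert t T} - {p. p permutes T}"
      then have p: "p permutes insert t T" "\<not> p permutes T" by auto
      have "p t \<noteq> t"
        using p permutes_superset[OF p(1), of T] by auto
      moreover obtain i where i: "p i = t" "i \<in> insert t T"
        using p(1) by (metis insertI1 permutes_def)
      ultimately have "i \<in> T" by auto
      then have "A i (p i) = 0" using assms(3) i by simp
      then have "(\<Prod>i\<in>insert t T. A i (p i)) = 0"
        using \<open>i \<in> T\<close> assms(1) by (intro prod_zero) auto
      then show "of_int (sign p) * (\<Prod>i\<in>insert t T. A i (p i)) = 0" by simp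
    qed
  qed
  also have "\<dots> = A t t * det_on T A"
    unfolding det_on_def sum_distrib_left
    using assms(1,2) by (intro sum.cong refl) (simp add: permutes_not_in)
  finally show ?thesis .
qed

lemma det_on_schur_complement:
  fixes A :: "'i \<Rightarrow> 'i \<Rightarrow> 'r::field_char_0"
  assumes "finite T" "t \<notin> T" "A t t \<noteq> 0"
  shows "det_on (insert t T) A = A t t * det_on T (schur_complement t A)"
proof -
  let ?B = "\<lambda>i k. if i \<in> T then A i k - A i t / A t t * A t k else A i k"
  have "det_on (insert t T) A = det_on (insert t T) ?B"
    using assms by (intro det_on_row_operations[symmetric]) auto
  also have "\<dots> = ?B t t * det_on T ?B"
    using assms by (intro det_on_insert_zero_column) auto
  also have "det_on T ?B = det_on T (schur_complement t A)"
    by (rule det_on_cong) (simp add: schur_complement_def)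
  finally show ?thesis using assms(2) by simp
qed

lemma det_on_identity_plus:
  assumes "finite I"
  shows "det_on I (\<lambda>i j. of_bool (i = j) + A i j) = (\<Sum>S\<in>Pow I. det_on S A)"
proof -
  define minor_term where
    "minor_term p S = of_int (sign p) * ((\<Prod>i\<in>S. A i (p i)) * (\<Prod>i\<in>I-S. of_bool (i = p i)))" for p S
  have "det_on I (\<lambda>i j. of_bool (i = j) + A i j) = (\<Sum>p | p permutes I. \<Sum>S\<in>Pow I. minor_term p S)"
  proof -
    have "(\<Prod>i\<in>I. of_bool (i = p i) + A i (p i)) =
        (\<Sum>S\<in>Pow I. (\<Prod>i\<in>S. A i (p i)) * (\<Prod>i\<in>I-S. of_bool (i = p i)))" for p
      by (subst add.commute) (rule prod_add[OF assms])
    then show ?thesis by (simp only: det_on_def minor_term_def sum_distrib_left)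
  qed
  also have "\<dots> = (\<Sum>S\<in>Pow I. \<Sum>p | p permutes I. minor_term p S)"
    by (rule sum.swap)
  also have "\<dots> = (\<Sum>S\<in>Pow I. det_on S A)"
  proof (rule sum.cong[OF refl])
    fix S assume S: "S \<in> Pow I"
    have "(\<Sum>p | p permutes I. minor_term p S) = (\<Sum>p | p permutes S. minor_term p S)"
    proof (rule sum.mono_neutral_right)
      show "finite {p. p permutes I}" using assms by (simp add: finite_permutations)
      show "{p. p permutes S} \<subseteq> {p. p permutes I}"
        using S by (auto intro: permutes_subset)
      show "\<forall>p\<in>{p. p permutes I} - {p. p permutes S}. minor_term p S = 0"
      proof
        fix p assume "p \<in> {p. p permutes I} - {p. p permutes S}"
        then obtain i where "i \<in> I - S" "p i \<noteq> i"
          using permutes_superset[of p I S] by auto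
        then have "(\<Prod>i\<in>I-S. of_bool (i = p i) :: 'b) = 0"
          using assms by (intro prod_zero) (auto intro!: bexI[of _ i] dest: sym)
        then show "minor_term p S = 0" by (simp add: minor_term_def)
      qed
    qed
    also have "\<dots> = det_on S A"
      unfolding det_on_def minor_term_def by (intro sum.cong refl) (simp add: permutes_not_in)
    finally show "(\<Sum>p | p permutes I. minor_term p S) = det_on S A" .
  qed
  finally show ?thesis .
qed

lemma det_on_scale:
  "det_on I (\<lambda>i j. u i * v j * A i j) = (\<Prod>i\<in>I. u i * v i) * det_on I A"
  unfolding det_on_def sum_distrib_left
proof (rule sum.cong[OF refl])
  fix p assume "p \<in> {p. p permutes I}"
  then have p: "p permutes I" by simp
  have "(\<Prod>i\<in>I. v (p i)) = (\<Prod>i\<in>I. v i)"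
    using prod.permute[OF p, of v] by (simp add: o_def)
  then show "of_int (sign p) * (\<Prod>i\<in>I. u i * v (p i) * A i (p i)) =
      (\<Prod>i\<in>I. u i * v i) * (of_int (sign p) * (\<Prod>i\<in>I. A i (p i)))"
    by (simp add: prod.distrib mult_ac)
qed

lemma det_on_reindex:
  assumes f: "bij_betw f J I" and "finite I"
  shows "det_on I A = det_on J (\<lambda>i j. A (f i) (f j))"
proof -
  have fin: "finite J" and inj: "inj_on f J" and im: "f ` J = I"
    using assms bij_betw_finite by (auto simp: bij_betw_def)
  have "det_on J (\<lambda>i j. A (f i) (f j)) =
      (\<Sum>p | p permutes J. of_int (sign (map_permutation J f p)) *
        (\<Prod>i\<in>I. A i (map_permutation J f p i)))"
    unfolding det_on_def
  proof (rule sum.cong[OF refl])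
    fix p assume "p \<in> {p. p permutes J}"
    then have p: "p permutes J" by simp
    have "(\<Prod>i\<in>I. A i (map_permutation J f p i)) = (\<Prod>i\<in>J. A (f i) (f (p i)))"
      unfolding im[symmetric] using inj
      by (subst prod.reindex) (auto simp: map_permutation_apply intro!: prod.cong)
    then show "of_int (sign p) * (\<Prod>i\<in>J. A (f i) (f (p i))) =
        of_int (sign (map_permutation J f p)) * (\<Prod>i\<in>I. A i (map_permutation J f p i))"
      using sign_map_permutation[OF inj p fin] by simp
  qed
  also have "\<dots> = det_on I A"
  proof -
    have "map_permutation J f = (\<lambda>p x. if x \<in> I then f (p (inv_into J f x)) else x)"
      by (auto simp: map_permutation_def restrict_id_def fun_eq_iff im)
    then have "bij_betw (map_permutation J f) {p. p permutes J} {p. p permutes I}"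
      using bij_betw_permutations[OF f] by simp
    then show ?thesis
      unfolding det_on_def by (rule sum.reindex_bij_betw)
  qed
  finally show ?thesis by simp
qed

section \<open>Positive semidefinite matrices\<close>

definition quad_form :: "'i set \<Rightarrow> ('i \<Rightarrow> 'i \<Rightarrow> real) \<Rightarrow> ('i \<Rightarrow> real) \<Rightarrow> real" where
  "quad_form I A c = (\<Sum>i\<in>I. \<Sum>j\<in>I. c i * c j * A i j)"

definition psd_on :: "'i set \<Rightarrow> ('i \<Rightarrow> 'i \<Rightarrow> real) \<Rightarrow> bool" where
  "psd_on I A \<longleftrightarrow> (\<forall>i\<in>I. \<forall>j\<in>I. A i j = A j i) \<and> (\<forall>c. 0 \<le> quad_form I A c)"

lemma psd_on_sym: "psd_on I A \<Longrightarrow> i \<in> I \<Longrightarrow> j \<in> I \<Longrightarrow> A i j = A j i"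
  unfolding psd_on_def by blast

lemma psd_on_quad_form_nonneg: "psd_on I A \<Longrightarrow> 0 \<le> quad_form I A c"
  unfolding psd_on_def by blast

lemma psd_onI:
  assumes "\<And>i j. i \<in> I \<Longrightarrow> j \<in> I \<Longrightarrow> A i j = A j i" "\<And>c. 0 \<le> quad_form I A c"
  shows "psd_on I A"
  using assms unfolding psd_on_def by blast

lemma quad_form_cong:
  assumes "\<And>i. i \<in> I \<Longrightarrow> c i = d i" "\<And>i j. i \<in> I \<Longrightarrow> j \<in> I \<Longrightarrow> A i j = B i j"
  shows "quad_form I A c = quad_form I B d"
  unfolding quad_form_def using assms by (intro sum.cong refl) simp

lemma quad_form_zero_extension:
  assumes "finite I" "J \<subseteq> I"
  shows "quad_form I A (\<lambda>i. if i \<in> J then c i else 0) = quad_form J A c"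
  unfolding quad_form_def using assms
  by (intro sum.mono_neutral_cong_right) (auto intro!: sum.mono_neutral_cong_right)

lemma quad_form_scale:
  "quad_form I (\<lambda>i j. v i * v j * A i j) c = quad_form I A (\<lambda>i. v i * c i)"
  by (simp add: quad_form_def mult_ac)

lemma quad_form_insert:
  assumes "finite T" "t \<notin> T" "\<And>i. i \<in> T \<Longrightarrow> A t i = A i t"
  shows "quad_form (insert t T) A c =
    (c t)\<^sup>2 * A t t + 2 * c t * (\<Sum>i\<in>T. c i * A i t) + quad_form T A c"
proof -
  have "(\<Sum>j\<in>T. c t * c j * A t j) = c t * (\<Sum>i\<in>T. c i * A i t)"
    using assms(3) by (simp add: sum_distrib_left mult.assoc)
  moreover have "(\<Sum>i\<in>T. c i * c t * A i t) = c t * (\<Sum>i\<in>T. c i * A i t)"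
    by (simp add: sum_distrib_left mult_ac)
  ultimately show ?thesis
    using assms(1,2) by (simp add: quad_form_def sum.distrib power2_eq_square)
qed

lemma quad_form_schur_complement:
  assumes "\<And>i. i \<in> T \<Longrightarrow> A t i = A i t"
  shows "quad_form T (schur_complement t A) c =
    quad_form T A c - (\<Sum>i\<in>T. c i * A i t)\<^sup>2 / A t t"
proof -
  have "(\<Sum>i\<in>T. c i * A i t)\<^sup>2 / A t t = (\<Sum>i\<in>T. \<Sum>j\<in>T. c i * c j * (A i t / A t t * A t j))"
    unfolding power2_eq_square sum_product sum_divide_distrib
    by (intro sum.cong refl) (simp add: assms)
  then show ?thesis
    by (simp add: quad_form_def schur_complement_def sum_subtractf right_diff_distrib)
qed

lemma psd_on_subset:
  assumes "psd_on I A" "finite I" "J \<subseteq> I"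
  shows "psd_on J A"
proof (rule psd_onI)
  show "A i j = A j i" if "i \<in> J" "j \<in> J" for i j
    using psd_on_sym[OF assms(1)] assms(3) that by blast
  show "0 \<le> quad_form J A c" for c
    using psd_on_quad_form_nonneg[OF assms(1)] quad_form_zero_extension[OF assms(2,3)] by metis
qed

lemma psd_on_diag_nonneg:
  assumes "psd_on I A" "finite I" "i \<in> I"
  shows "0 \<le> A i i"
proof -
  have "psd_on {i} A" using assms by (intro psd_on_subset[OF assms(1)]) auto
  from psd_on_quad_form_nonneg[OF this, of "\<lambda>_. 1"] show ?thesis
    by (simp add: quad_form_def)
qed

lemma psd_on_zero_diag:
  assumes psd: "psd_on I A" and "finite I" "i \<in> I" "t \<in> I" "A t t = 0"
  shows "A i t = 0"
proof (rule ccontr)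
  assume offdiag: "A i t \<noteq> 0"
  then have "i \<noteq> t" using assms(5) by auto
  let ?c = "\<lambda>k. if k = i then 1 else - (A i i + 1) / (2 * A i t)"
  have "psd_on {t, i} A" using assms by (intro psd_on_subset[OF psd]) auto
  then have "0 \<le> quad_form {t, i} A ?c" by (rule psd_on_quad_form_nonneg)
  also have "\<dots> = 2 * ?c t * A i t + A i i"
    using \<open>i \<noteq> t\<close> assms(5) psd_on_sym[OF psd assms(3,4)]
    by (subst quad_form_insert) (auto simp: quad_form_def)
  also have "\<dots> = -1" using \<open>i \<noteq> t\<close> offdiag by (simp add: field_simps)
  finally show False by simp
qed

text \<open>If \<open>A t t = 0\<close>, then \<open>schur_complement t A = A\<close> because \<open>x/0 = 0\<close>. Since the whole row of \<open>t\<close>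
  vanishes in that case, the next three lemmas hold without assuming \<open>A t t > 0\<close>.\<close>

lemma quad_form_complete_square:
  assumes psd: "psd_on (insert t T) A" and fresh: "finite T" "t \<notin> T"
  shows "quad_form (insert t T) A c =
    A t t * (c t + (\<Sum>i\<in>T. c i * A i t) / A t t)\<^sup>2 + quad_form T (schur_complement t A) c"
proof -
  have sym: "A t i = A i t" if "i \<in> T" for i
    using that by (intro psd_on_sym[OF psd]) auto
  define s where "s = (\<Sum>i\<in>T. c i * A i t)"
  have "s = 0" if "A t t = 0"
    unfolding s_def using psd_on_zero_diag[OF psd _ _ _ that] fresh by simp
  then have "A t t * (c t + s / A t t)\<^sup>2 = (c t)\<^sup>2 * A t t + 2 * c t * s + s\<^sup>2 / A t t"
    by (cases "A t t = 0") (auto simp: field_simps power2_eq_square)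
  then show ?thesis
    using quad_form_schur_complement[of T A t c, OF sym] quad_form_insert[OF fresh, of A c] sym
    by (simp add: s_def)
qed

lemma psd_on_schur_complement:
  assumes psd: "psd_on (insert t T) A" and fresh: "finite T" "t \<notin> T"
  shows "psd_on T (schur_complement t A)"
proof (rule psd_onI)
  show "schur_complement t A i j = schur_complement t A j i" if "i \<in> T" "j \<in> T" for i j
    using psd_on_sym[OF psd] that by (simp add: schur_complement_def)
  fix c
  let ?d = "c(t := - (\<Sum>i\<in>T. c i * A i t) / A t t)"
  have "(\<Sum>i\<in>T. ?d i * A i t) = (\<Sum>i\<in>T. c i * A i t)"
    using fresh by (intro sum.cong) auto
  then have "quad_form (insert t T) A ?d = quad_form T (schur_complement t A) ?d"
    unfolding quad_form_complete_square[OF assms] by simp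
  also have "\<dots> = quad_form T (schur_complement t A) c"
    using fresh by (intro quad_form_cong) auto
  finally show "0 \<le> quad_form T (schur_complement t A) c"
    using psd_on_quad_form_nonneg[OF psd] by metis
qed

lemma det_on_insert_psd_on:
  assumes psd: "psd_on (insert t T) A" and fresh: "finite T" "t \<notin> T"
  shows "det_on (insert t T) A = A t t * det_on T (schur_complement t A)"
proof (cases "A t t = 0")
  case True
  then have "A i t = 0" if "i \<in> T" for i
    using psd_on_zero_diag[OF psd] fresh that by simp
  then show ?thesis
    using True fresh by (simp add: det_on_insert_zero_column)
next
  case False
  then show ?thesis using fresh by (intro det_on_schur_complement)
qed

lemma det_on_nonneg:
  assumes "finite I" "psd_on I A"
  shows "0 \<le> det_on I A"
  using assms
proof (induction I arbitrary: A)
  case (insert t T)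
  have "0 \<le> A t t"
    using insert by (intro psd_on_diag_nonneg[OF insert.prems]) auto
  then show ?case
    using insert by (simp add: det_on_insert_psd_on psd_on_schur_complement)
qed simp

lemma hadamard_inequality:
  assumes "finite I" "psd_on I A"
  shows "det_on I A \<le> (\<Prod>i\<in>I. A i i)"
  using assms
proof (induction I arbitrary: A)
  case (insert t T)
  have diag: "0 \<le> A i i" if "i \<in> insert t T" for i
    using insert.hyps that by (intro psd_on_diag_nonneg[OF insert.prems]) auto
  have psd: "psd_on T (schur_complement t A)"
    using insert by (intro psd_on_schur_complement)
  have "det_on T (schur_complement t A) \<le> (\<Prod>i\<in>T. schur_complement t A i i)"
    by (rule insert.IH[OF psd])
  also have "\<dots> \<le> (\<Prod>i\<in>T. A i i)"
  proof (rule prod_mono, intro conjI)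
    fix i assume i: "i \<in> T"
    show "0 \<le> schur_complement t A i i"
      by (rule psd_on_diag_nonneg[OF psd insert.hyps(1) i])
    have "A t i = A i t" using i by (intro psd_on_sym[OF insert.prems]) auto
    then show "schur_complement t A i i \<le> A i i"
      using diag[of t] by (simp add: schur_complement_def)
  qed
  finally have "A t t * det_on T (schur_complement t A) \<le> A t t * (\<Prod>i\<in>T. A i i)"
    using diag by (intro mult_left_mono) auto
  then show ?case
    using insert by (simp add: det_on_insert_psd_on)
qed simp

lemma psd_on_gram_decomposition:
  assumes "finite I" "psd_on I A"
  obtains P where "\<And>i j. i \<in> I \<Longrightarrow> j \<in> I \<Longrightarrow> A i j = (\<Sum>b\<in>I. P b i * P b j)"
proof -
  have "\<exists>P. \<forall>i\<in>I. \<forall>j\<in>I. A i j = (\<Sum>b\<in>I. P b i * P b j)"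
    using assms
  proof (induction I arbitrary: A)
    case (insert t T)
    have pivot: "0 \<le> A t t"
      using insert.hyps by (intro psd_on_diag_nonneg[OF insert.prems]) auto
    have sym: "A i t = A t i" if "i \<in> insert t T" for i
      using that by (intro psd_on_sym[OF insert.prems]) auto
    have row_zero: "A t i = 0" if "A t t = 0" "i \<in> insert t T" for i
      using psd_on_zero_diag[OF insert.prems _ that(2) _ that(1)] insert.hyps sym[OF that(2)] by simp
    obtain P where P: "schur_complement t A i j = (\<Sum>b\<in>T. P b i * P b j)" if "i \<in> T" "j \<in> T" for i j
      using insert.IH[OF psd_on_schur_complement[OF insert.prems insert.hyps]] by blast
    define Q where
      "Q b i = (if b = t then A t i / sqrt (A t t) else if i = t then 0 else P b i)" for b i
    have "A i j = (\<Sum>b\<in>insert t T. Q b i * Q b j)" if ij: "i \<in> insert t T" "j \<in> insert t T" for i j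
    proof -
      have "(\<Sum>b\<in>T. Q b i * Q b j) = (if i = t \<or> j = t then 0 else schur_complement t A i j)"
        using insert.hyps P[of i j] ij by (auto simp: Q_def intro!: sum.cong sum.neutral)
      moreover have "Q t i * Q t j = A i t / A t t * A t j"
        using pivot sym[OF ij(1)] by (simp add: Q_def)
      ultimately show ?thesis
        using insert.hyps row_zero[OF _ ij(1)] row_zero[OF _ ij(2)] sym[OF ij(1)]
        by (cases "A t t = 0") (auto simp: schur_complement_def)
    qed
    then show ?case by blast
  qed simp
  then show ?thesis using that by blast
qed

lemma psd_on_scale:
  assumes "psd_on I A"
  shows "psd_on I (\<lambda>i j. v i * v j * A i j)"
  using psd_on_sym[OF assms] psd_on_quad_form_nonneg[OF assms]
  by (intro psd_onI) (auto simp: quad_form_scale)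

lemma psd_on_image:
  assumes "finite I" "psd_on (p ` I) A"
  shows "psd_on I (\<lambda>i j. A (p i) (p j))"
proof (rule psd_onI)
  show "A (p i) (p j) = A (p j) (p i)" if "i \<in> I" "j \<in> I" for i j
    using that by (intro psd_on_sym[OF assms(2)]) auto
  fix c :: "'a \<Rightarrow> real"
  define d where "d u = (\<Sum>i | i \<in> I \<and> p i = u. c i)" for u
  have group: "(\<Sum>i\<in>I. c i * g (p i)) = (\<Sum>u\<in>p ` I. d u * g u)" for g
    unfolding d_def sum.image_gen[OF assms(1), of _ p] by (simp add: sum_distrib_right)
  have "quad_form I (\<lambda>i j. A (p i) (p j)) c = (\<Sum>i\<in>I. c i * (\<Sum>j\<in>I. c j * A (p i) (p j)))"
    by (simp add: quad_form_def sum_distrib_left mult.assoc)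
  also have "\<dots> = (\<Sum>u\<in>p ` I. d u * (\<Sum>v\<in>p ` I. d v * A u v))"
    unfolding group by (rule group)
  also have "\<dots> = quad_form (p ` I) A d"
    by (simp add: quad_form_def sum_distrib_left mult.assoc)
  finally show "0 \<le> quad_form I (\<lambda>i j. A (p i) (p j)) c"
    using psd_on_quad_form_nonneg[OF assms(2)] by simp
qed

lemma psd_on_schur_product:
  assumes "finite I" and A: "psd_on I A" and B: "psd_on I B"
  shows "psd_on I (\<lambda>i j. A i j * B i j)"
proof (rule psd_onI)
  show "A i j * B i j = A j i * B j i" if "i \<in> I" "j \<in> I" for i j
    using psd_on_sym[OF A that] psd_on_sym[OF B that] by simp
  fix c
  obtain P where P: "\<And>i j. i \<in> I \<Longrightarrow> j \<in> I \<Longrightarrow> A i j = (\<Sum>b\<in>I. P b i * P b j)"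
    using psd_on_gram_decomposition[OF assms(1) A] by blast
  define f where "f b i j = (P b i * c i) * (P b j * c j) * B i j" for b i j
  have "quad_form I (\<lambda>i j. A i j * B i j) c = (\<Sum>i\<in>I. \<Sum>j\<in>I. \<Sum>b\<in>I. f b i j)"
    unfolding quad_form_def f_def
    by (intro sum.cong refl) (simp add: P sum_distrib_left sum_distrib_right mult_ac)
  also have "\<dots> = (\<Sum>i\<in>I. \<Sum>b\<in>I. \<Sum>j\<in>I. f b i j)"
    by (intro sum.cong refl sum.swap)
  also have "\<dots> = (\<Sum>b\<in>I. \<Sum>i\<in>I. \<Sum>j\<in>I. f b i j)"
    by (rule sum.swap)
  also have "\<dots> = (\<Sum>b\<in>I. quad_form I B (\<lambda>i. P b i * c i))"
    by (simp add: quad_form_def f_def)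
  also have "\<dots> \<ge> 0"
    by (intro sum_nonneg psd_on_quad_form_nonneg[OF B])
  finally show "0 \<le> quad_form I (\<lambda>i j. A i j * B i j) c" .
qed

lemma psd_on_power:
  assumes "finite I" "psd_on I A"
  shows "psd_on I (\<lambda>i j. A i j ^ n)"
proof (induction n)
  case 0
  have "quad_form I (\<lambda>_ _. 1) c = (\<Sum>i\<in>I. c i)\<^sup>2" for c
    by (simp add: quad_form_def power2_eq_square sum_product)
  then show ?case by (intro psd_onI) auto
next
  case (Suc n)
  then show ?case using psd_on_schur_product[OF assms Suc] by simp
qed

lemma psd_on_exp:
  assumes "finite I" "psd_on I A"
  shows "psd_on I (\<lambda>i j. exp (A i j))"
proof (rule psd_onI)
  show "exp (A i j) = exp (A j i)" if "i \<in> I" "j \<in> I" for i j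
    using psd_on_sym[OF assms(2) that] by simp
  fix c
  have series: "(\<lambda>n. quad_form I (\<lambda>i j. A i j ^ n) c /\<^sub>R fact n) sums quad_form I (\<lambda>i j. exp (A i j)) c"
  proof -
    have "(\<lambda>n. \<Sum>i\<in>I. \<Sum>j\<in>I. c i * c j * (A i j ^ n /\<^sub>R fact n)) sums quad_form I (\<lambda>i j. exp (A i j)) c"
      unfolding quad_form_def by (intro sums_sum sums_mult exp_converges)
    then show ?thesis by (simp add: quad_form_def sum_distrib_left mult_ac)
  qed
  have "0 \<le> quad_form I (\<lambda>i j. A i j ^ n) c /\<^sub>R fact n" for n
    using psd_on_quad_form_nonneg[OF psd_on_power[OF assms]] by simp
  then show "0 \<le> quad_form I (\<lambda>i j. exp (A i j)) c"
    by (rule sums_le[OF _ sums_zero series])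
qed

lemma psd_on_identity_plus:
  assumes "finite I" and A: "psd_on I A"
    and bound: "\<And>c. quad_form I A c \<le> r * (\<Sum>i\<in>I. (c i)\<^sup>2)" and "0 \<le> 1 + z * r"
  shows "psd_on I (\<lambda>i j. of_bool (i = j) + z * A i j)"
proof (rule psd_onI)
  show "of_bool (i = j) + z * A i j = of_bool (j = i) + z * A j i" if "i \<in> I" "j \<in> I" for i j
    using psd_on_sym[OF A that] by auto
  fix c
  have "quad_form I (\<lambda>i j. of_bool (i = j) + z * A i j) c = (\<Sum>i\<in>I. (c i)\<^sup>2) + z * quad_form I A c"
    using assms(1)
    by (simp add: quad_form_def distrib_left sum.distrib sum_distrib_left power2_eq_square mult_ac
        of_bool_def if_distrib[of "\<lambda>x. _ * x"] cong: if_cong)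
  also have "\<dots> \<ge> 0"
  proof (cases "0 \<le> z")
    case True
    then show ?thesis
      by (intro add_nonneg_nonneg sum_nonneg mult_nonneg_nonneg psd_on_quad_form_nonneg[OF A]) auto
  next
    case False
    have "0 \<le> (1 + z * r) * (\<Sum>i\<in>I. (c i)\<^sup>2)"
      using assms(4) by (intro mult_nonneg_nonneg sum_nonneg) auto
    also have "\<dots> = (\<Sum>i\<in>I. (c i)\<^sup>2) + z * (r * (\<Sum>i\<in>I. (c i)\<^sup>2))"
      by (simp add: algebra_simps)
    also have "\<dots> \<le> (\<Sum>i\<in>I. (c i)\<^sup>2) + z * quad_form I A c"
      using False bound by (intro add_left_mono mult_left_mono_neg) auto
    finally show ?thesis .
  qed
  finally show "0 \<le> quad_form I (\<lambda>i j. of_bool (i = j) + z * A i j) c" .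
qed

lemma schur_test:
  assumes sym: "\<And>i j. i \<in> I \<Longrightarrow> j \<in> I \<Longrightarrow> A i j = A j i"
    and row: "\<And>i. i \<in> I \<Longrightarrow> (\<Sum>j\<in>I. \<bar>A i j\<bar> * (w j)\<^sup>2) \<le> r"
  shows "quad_form I (\<lambda>i j. w i * w j * A i j) c \<le> r * (\<Sum>i\<in>I. (c i)\<^sup>2)"
proof -
  define f where "f i j = (c i)\<^sup>2 * (\<bar>A i j\<bar> * (w j)\<^sup>2)" for i j
  have "quad_form I (\<lambda>i j. w i * w j * A i j) c \<le> (\<Sum>i\<in>I. \<Sum>j\<in>I. f i j / 2 + f j i / 2)"
    unfolding quad_form_def
  proof (intro sum_mono)
    fix i j assume ij: "i \<in> I" "j \<in> I"
    have "0 \<le> (\<bar>c i * w j\<bar> - \<bar>c j * w i\<bar>)\<^sup>2" by simp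
    then have "\<bar>c i * w j\<bar> * \<bar>c j * w i\<bar> \<le> ((c i * w j)\<^sup>2 + (c j * w i)\<^sup>2) / 2"
      by (simp add: power2_diff)
    then have "\<bar>c i * w j\<bar> * \<bar>c j * w i\<bar> * \<bar>A i j\<bar> \<le> ((c i * w j)\<^sup>2 + (c j * w i)\<^sup>2) / 2 * \<bar>A i j\<bar>"
      by (rule mult_right_mono) simp
    moreover have "c i * c j * (w i * w j * A i j) \<le> \<bar>c i * c j * (w i * w j * A i j)\<bar>"
      by simp
    ultimately show "c i * c j * (w i * w j * A i j) \<le> f i j / 2 + f j i / 2"
      using sym[OF ij] by (simp add: f_def abs_mult algebra_simps)
  qed
  also have "\<dots> = (\<Sum>i\<in>I. \<Sum>j\<in>I. f i j / 2) + (\<Sum>i\<in>I. \<Sum>j\<in>I. f j i / 2)"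
    by (simp add: sum.distrib)
  also have "(\<Sum>i\<in>I. \<Sum>j\<in>I. f j i / 2) = (\<Sum>i\<in>I. \<Sum>j\<in>I. f i j / 2)"
    by (rule sum.swap)
  also have "(\<Sum>i\<in>I. \<Sum>j\<in>I. f i j / 2) + \<dots> = (\<Sum>i\<in>I. (c i)\<^sup>2 * (\<Sum>j\<in>I. \<bar>A i j\<bar> * (w j)\<^sup>2))"
    by (simp add: f_def sum_distrib_left sum_divide_distrib[symmetric])
  also have "\<dots> \<le> (\<Sum>i\<in>I. (c i)\<^sup>2 * r)"
    using row by (intro sum_mono mult_left_mono) auto
  finally show ?thesis by (simp add: sum_distrib_left mult.commute)
qed

section \<open>The Gaussian kernel\<close>

definition psd_operator :: "('a::real_inner \<Rightarrow> 'a) \<Rightarrow> bool" where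
  "psd_operator T \<longleftrightarrow> linear T \<and> (\<forall>x y. x \<bullet> T y = y \<bullet> T x) \<and> (\<forall>x. 0 \<le> x \<bullet> T x)"

lemma quad_form_inner:
  assumes "linear T"
  shows "quad_form F (\<lambda>x y. x \<bullet> T y) c = (\<Sum>x\<in>F. c x *\<^sub>R x) \<bullet> T (\<Sum>x\<in>F. c x *\<^sub>R x)"
  unfolding quad_form_def
  by (subst sum.swap)
    (simp add: inner_sum_left inner_sum_right linear_sum[OF assms] linear_cmul[OF assms]
      sum_distrib_left mult_ac)

lemma psd_on_inner:
  assumes "psd_operator T"
  shows "psd_on F (\<lambda>x y. x \<bullet> T y)"
  using assms unfolding psd_operator_def by (intro psd_onI) (auto simp: quad_form_inner)

lemma psd_on_gaussian:
  assumes "psd_operator T" "finite F"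
  shows "psd_on F (\<lambda>x y. exp (- (1/2) * ((x - y) \<bullet> T (x - y))))"
proof -
  have T: "linear T" "\<And>x y. x \<bullet> T y = y \<bullet> T x"
    using assms(1) unfolding psd_operator_def by blast+
  define v where "v x = exp (- (1/2) * (x \<bullet> T x))" for x
  have "exp (- (1/2) * ((x - y) \<bullet> T (x - y))) = v x * v y * exp (x \<bullet> T y)" for x y
  proof -
    have "(x - y) \<bullet> T (x - y) = x \<bullet> T x - 2 * (x \<bullet> T y) + y \<bullet> T y"
      using T(2)[of x y] by (simp add: linear_diff[OF T(1)] inner_diff_left inner_diff_right)
    then show ?thesis by (simp add: v_def exp_add[symmetric] field_simps)
  qed
  then show ?thesis
    using psd_on_scale[OF psd_on_exp[OF assms(2) psd_on_inner[OF assms(1)]], of v] by simp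
qed

lemma nn_integral_gaussian_real:
  fixes a m :: real
  assumes "a > 0"
  shows "(\<integral>\<^sup>+ y. ennreal (exp (- (1/2) * (a * (y + m)\<^sup>2))) \<partial>lborel) = ennreal (sqrt (2 * pi) / sqrt a)"
proof -
  let ?c = "sqrt (2 * pi) / sqrt a"
  have "exp (- (1/2) * (a * (y + m)\<^sup>2)) = ?c * normal_density (-m) (1 / sqrt a) y" for y
    using assms
    by (simp add: normal_density_def power_divide real_sqrt_divide real_sqrt_mult field_simps)
  then have "(\<integral>\<^sup>+ y. ennreal (exp (- (1/2) * (a * (y + m)\<^sup>2))) \<partial>lborel) =
      (\<integral>\<^sup>+ y. ennreal ?c * ennreal (normal_density (-m) (1 / sqrt a) y) \<partial>lborel)"
    using assms by (intro nn_integral_cong) (simp only: ennreal_mult'' normal_density_nonneg)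
  also have "\<dots> = ennreal ?c * (\<integral>\<^sup>+ y. ennreal (normal_density (-m) (1 / sqrt a) y) \<partial>lborel)"
    by (rule nn_integral_cmult) simp
  also have "(\<integral>\<^sup>+ y. ennreal (normal_density (-m) (1 / sqrt a) y) \<partial>lborel) = 1"
    using assms by (subst nn_integral_eq_integral) auto
  finally show ?thesis by simp
qed

lemma nn_integral_gaussian_coordinate:
  assumes psd: "psd_on (insert t T) A" and fresh: "finite T" "t \<notin> T" and "A t t > 0"
  shows "(\<integral>\<^sup>+ y. ennreal (exp (- (1/2) * quad_form (insert t T) A (x(t := y)))) \<partial>lborel) =
    ennreal (exp (- (1/2) * quad_form T (schur_complement t A) x)) *
    ennreal (sqrt (2 * pi) / sqrt (A t t))"
    (is "_ = ennreal ?r * _")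
proof -
  define m where "m = (\<Sum>i\<in>T. x i * A i t) / A t t"
  have square: "quad_form (insert t T) A (x(t := y)) =
      A t t * (y + m)\<^sup>2 + quad_form T (schur_complement t A) x" for y
  proof -
    have "(\<Sum>i\<in>T. (x(t := y)) i * A i t) = (\<Sum>i\<in>T. x i * A i t)"
      using fresh by (intro sum.cong) auto
    moreover have "quad_form T (schur_complement t A) (x(t := y)) =
        quad_form T (schur_complement t A) x"
      using fresh by (intro quad_form_cong) auto
    ultimately show ?thesis
      using quad_form_complete_square[OF psd fresh, of "x(t := y)"] by (simp add: m_def)
  qed
  have "(\<integral>\<^sup>+ y. ennreal (exp (- (1/2) * quad_form (insert t T) A (x(t := y)))) \<partial>lborel) =
      (\<integral>\<^sup>+ y. ennreal ?r * ennreal (exp (- (1/2) * (A t t * (y + m)\<^sup>2))) \<partial>lborel)"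
    unfolding square
    by (intro nn_integral_cong) (simp add: ennreal_mult[symmetric] exp_add[symmetric] field_simps)
  also have "\<dots> = ennreal ?r * (\<integral>\<^sup>+ y. ennreal (exp (- (1/2) * (A t t * (y + m)\<^sup>2))) \<partial>lborel)"
    by (rule nn_integral_cmult) measurable
  finally show ?thesis unfolding nn_integral_gaussian_real[OF assms(4)] .
qed

lemma nn_integral_gaussian_PiM:
  assumes "finite I" "psd_on I A" "det_on I A \<noteq> 0"
  shows "(\<integral>\<^sup>+ x. ennreal (exp (- (1/2) * quad_form I A x)) \<partial>PiM I (\<lambda>_. lborel)) =
    ennreal (sqrt (2 * pi) ^ card I / sqrt (det_on I A))"
  using assms
proof (induction I arbitrary: A)
  case empty
  show ?case by (simp add: PiM_empty nn_integral_count_space_finite quad_form_def)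
next
  case (insert t T)
  interpret product_sigma_finite "\<lambda>_::'a. lborel::real measure"
    by (intro product_sigma_finite.intro) (rule sigma_finite_lborel)
  let ?B = "schur_complement t A"
  let ?g = "\<lambda>q. ennreal (exp (- (1/2) * q))"
  have det: "det_on (insert t T) A = A t t * det_on T ?B"
    using insert.prems(1) insert.hyps by (rule det_on_insert_psd_on)
  have "0 \<le> A t t"
    using insert.hyps by (intro psd_on_diag_nonneg[OF insert.prems(1)]) auto
  with det insert.prems(2) have pivot: "A t t > 0" by auto
  have psd: "psd_on T ?B"
    using insert.prems(1) insert.hyps by (rule psd_on_schur_complement)
  have "(\<integral>\<^sup>+ x. ?g (quad_form (insert t T) A x) \<partial>PiM (insert t T) (\<lambda>_. lborel)) =
     (\<integral>\<^sup>+ x. (\<integral>\<^sup>+ y. ?g (quad_form (insert t T) A (x(t := y))) \<partial>lborel) \<partial>PiM T (\<lambda>_. lborel))"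
    using insert.hyps by (intro product_nn_integral_insert) (auto simp: quad_form_def)
  also have "\<dots> = (\<integral>\<^sup>+ x. ?g (quad_form T ?B x) \<partial>PiM T (\<lambda>_. lborel)) *
      ennreal (sqrt (2 * pi) / sqrt (A t t))"
    unfolding nn_integral_gaussian_coordinate[OF insert.prems(1) insert.hyps pivot]
    by (rule nn_integral_multc) (simp add: quad_form_def)
  also have "(\<integral>\<^sup>+ x. ?g (quad_form T ?B x) \<partial>PiM T (\<lambda>_. lborel)) =
      ennreal (sqrt (2 * pi) ^ card T / sqrt (det_on T ?B))"
    using det insert.prems(2) by (intro insert.IH[OF psd]) auto
  also have "\<dots> * ennreal (sqrt (2 * pi) / sqrt (A t t)) =
      ennreal (sqrt (2 * pi) ^ card (insert t T) / sqrt (det_on (insert t T) A))"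
    using det_on_nonneg[OF _ psd] insert.hyps pivot
    by (simp add: det ennreal_mult[symmetric] real_sqrt_mult mult_ac)
  finally show ?case .
qed

lemma nn_integral_gaussian_lborel:
  fixes T :: "'a::euclidean_space \<Rightarrow> 'a"
  assumes "psd_operator T" and det: "det_on Basis (\<lambda>b c. b \<bullet> T c) \<noteq> 0"
  shows "(\<integral>\<^sup>+ x. ennreal (exp (- (1/2) * (x \<bullet> T x))) \<partial>lborel) =
    ennreal (sqrt (2 * pi) ^ DIM('a) / sqrt (det_on Basis (\<lambda>b c. b \<bullet> T c)))"
proof -
  have T: "linear T" using assms(1) by (simp add: psd_operator_def)
  have [measurable]: "T \<in> borel_measurable borel"
    using T by (intro borel_measurable_continuous_onI linear_continuous_on
        linear_conv_bounded_linear[THEN iffD1])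
  have "(\<integral>\<^sup>+ x. ennreal (exp (- (1/2) * (x \<bullet> T x))) \<partial>lborel) =
      (\<integral>\<^sup>+ c. ennreal (exp (- (1/2) * quad_form Basis (\<lambda>b c. b \<bullet> T c) c)) \<partial>PiM Basis (\<lambda>_. lborel))"
    unfolding quad_form_inner[OF T] by (subst lborel_eq, subst nn_integral_distr) auto
  also have "\<dots> = ennreal (sqrt (2 * pi) ^ DIM('a) / sqrt (det_on Basis (\<lambda>b c. b \<bullet> T c)))"
    by (rule nn_integral_gaussian_PiM[OF finite_Basis psd_on_inner[OF assms(1)] det])
  finally show ?thesis .
qed

lemma det_on_Basis_matrix:
  fixes A :: "real^'n^'n"
  shows "det_on Basis (\<lambda>b c. b \<bullet> (A *v c)) = det A"
proof -
  have "bij_betw (\<lambda>i. axis i 1) UNIV (Basis :: (real^'n) set)"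
    by (auto simp: bij_betw_def inj_on_def axis_eq_axis Basis_vec_def)
  then have "det_on Basis (\<lambda>b c. b \<bullet> (A *v c)) = det_on UNIV (\<lambda>i j. axis i 1 \<bullet> (A *v axis j 1))"
    by (intro det_on_reindex) auto
  also have "\<dots> = det A"
    by (simp add: matrix_vector_mult_basis column_def inner_axis' det_on_def det_def)
  finally show ?thesis .
qed

lemma matrix_inv_right:
  fixes A :: "'a::semiring_1^'n^'m"
  assumes "invertible A"
  shows "A ** matrix_inv A = mat 1"
  using someI_ex[OF assms[unfolded invertible_def]] by (auto simp: matrix_inv_def)

lemma pos_def_matrix_invertible:
  fixes S :: "real^'n^'n"
  assumes "pos_def_matrix S"
  shows "invertible S"
proof -
  have "x = 0" if "S *v x = 0" for x
    using assms that unfolding pos_def_matrix_def by (metis inner_zero_right less_irrefl)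
  then show ?thesis
    by (metis invertible_left_inverse matrix_left_invertible_ker)
qed

lemma psd_operator_pos_def_matrix_inv:
  fixes S :: "real^'n^'n"
  assumes "pos_def_matrix S"
  shows "psd_operator ((*v) (matrix_inv S))"
proof -
  have S: "transpose S = S" "\<And>x. x \<noteq> 0 \<Longrightarrow> 0 < x \<bullet> (S *v x)"
    using assms by (auto simp: pos_def_matrix_def)
  have inv: "S *v (matrix_inv S *v x) = x" for x
    using matrix_inv_right[OF pos_def_matrix_invertible[OF assms]]
    by (simp add: matrix_vector_mul_assoc)
  have inner_S: "x \<bullet> (S *v y) = (S *v x) \<bullet> y" for x y
    using S(1) by (metis dot_lmul_matrix transpose_matrix_vector)
  have "x \<bullet> (matrix_inv S *v y) = y \<bullet> (matrix_inv S *v x)" for x y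
    using inner_S[of "matrix_inv S *v x" "matrix_inv S *v y"] by (simp add: inv inner_commute)
  moreover have "0 \<le> x \<bullet> (matrix_inv S *v x)" for x
    using S(2)[of "matrix_inv S *v x"] by (cases "matrix_inv S *v x = 0") (auto simp: inv inner_commute)
  ultimately show ?thesis by (simp add: psd_operator_def matrix_vector_mul_linear)
qed

lemma pos_def_matrix_det:
  fixes S :: "real^'n^'n"
  assumes "pos_def_matrix S"
  shows "0 < det S" "det (matrix_inv S) = 1 / det S"
proof -
  have det_inv: "det S * det (matrix_inv S) = 1"
    by (simp only: det_mul[symmetric] det_I matrix_inv_right[OF pos_def_matrix_invertible[OF assms]])
  have "0 \<le> det (matrix_inv S)"
    using det_on_nonneg[OF finite_Basis psd_on_inner[OF psd_operator_pos_def_matrix_inv[OF assms]]]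
    by (simp add: det_on_Basis_matrix)
  with det_inv show "0 < det S"
    by (metis mult_eq_0_iff mult_nonpos_nonneg not_le not_one_le_zero)
  then show "det (matrix_inv S) = 1 / det S"
    using det_inv by (simp add: eq_divide_eq mult.commute)
qed

lemma continuous_gauss_kernel: "continuous_on UNIV (\<lambda>(x, y). gauss_kernel S x y)"
  unfolding gauss_kernel_def case_prod_beta divide_inverse
  by (intro continuous_intros bounded_linear.continuous_on[OF matrix_vector_mul_bounded_linear])

lemma gauss_kernel_nonneg:
  assumes "pos_def_matrix S"
  shows "0 \<le> gauss_kernel S x y"
  using pos_def_matrix_det(1)[OF assms] by (simp add: gauss_kernel_def)

lemma psd_on_gauss_kernel:
  assumes "pos_def_matrix S" "finite F"
  shows "psd_on F (gauss_kernel S)"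
proof -
  let ?c = "(2 * pi) powr (real CARD('a) / 2) * sqrt (det S)"
  have "0 \<le> ?c" using pos_def_matrix_det(1)[OF assms(1)] by simp
  then have "gauss_kernel S x y = 1 / sqrt ?c * (1 / sqrt ?c) *
      exp (- (1/2) * ((x - y) \<bullet> (matrix_inv S *v (x - y))))" for x y
    by (simp add: gauss_kernel_def)
  then show ?thesis
    using psd_on_scale[OF psd_on_gaussian[OF psd_operator_pos_def_matrix_inv[OF assms(1)] assms(2)],
        of "\<lambda>_. 1 / sqrt ?c"]
    by presburger
qed

lemma nn_integral_gauss_kernel:
  fixes S :: "real^'n^'n"
  assumes "pos_def_matrix S"
  shows "(\<integral>\<^sup>+ y. ennreal (gauss_kernel S x y) \<partial>lborel) = 1"
proof -
  note psd = psd_operator_pos_def_matrix_inv[OF assms] and det = pos_def_matrix_det[OF assms]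
  define c where "c = (2 * pi) powr (real CARD('n) / 2) * sqrt (det S)"
  have "c > 0" using det(1) by (simp add: c_def)
  let ?q = "\<lambda>x. exp (- (1/2) * (x \<bullet> (matrix_inv S *v x)))"
  have [measurable]: "?q \<in> borel_measurable borel"
    by (auto intro!: borel_measurable_continuous_onI continuous_intros
        matrix_vector_mult_linear_continuous_on)
  have "(x - y) \<bullet> (matrix_inv S *v (x - y)) = (- x + y) \<bullet> (matrix_inv S *v (- x + y))" for y
    by (simp add: matrix_vector_mult_diff_distrib inner_diff_left inner_diff_right algebra_simps)
  then have "gauss_kernel S x y = ?q (- x + y) / c" for y
    by (simp add: gauss_kernel_def c_def)
  then have "(\<integral>\<^sup>+ y. ennreal (gauss_kernel S x y) \<partial>lborel) =
      (\<integral>\<^sup>+ y. ennreal (1 / c) * ennreal (?q (- x + y)) \<partial>lborel)"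
    using \<open>c > 0\<close> by (intro nn_integral_cong) (simp add: ennreal_mult[symmetric])
  also have "\<dots> = ennreal (1 / c) * (\<integral>\<^sup>+ y. ennreal (?q (- x + y)) \<partial>lborel)"
    by (rule nn_integral_cmult) measurable
  also have "(\<integral>\<^sup>+ y. ennreal (?q (- x + y)) \<partial>lborel) =
      (\<integral>\<^sup>+ y. ennreal (?q y) \<partial>distr lborel borel ((+) (- x)))"
    by (intro nn_integral_distr[symmetric]) measurable
  also have "\<dots> = ennreal (sqrt (2 * pi) ^ CARD('n) / sqrt (det (matrix_inv S)))"
    using nn_integral_gaussian_lborel[OF psd] det
    by (simp add: lborel_distr_plus det_on_Basis_matrix)
  also have "sqrt (2 * pi) ^ CARD('n) / sqrt (det (matrix_inv S)) = c"
    using det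
    by (simp add: c_def real_sqrt_divide powr_half_sqrt[symmetric] powr_powr powr_realpow[symmetric])
  also have "ennreal (1 / c) * ennreal c = 1"
    using \<open>c > 0\<close> by (simp add: ennreal_mult[symmetric])
  finally show ?thesis .
qed

section \<open>Sampling the cells of a partition\<close>

definition fine_borel_partition :: "'a::metric_space set \<Rightarrow> real \<Rightarrow> 'a set set \<Rightarrow> bool" where
  "fine_borel_partition B e \<P> \<longleftrightarrow> finite \<P> \<and> partition_on B \<P> \<and> \<P> \<subseteq> sets borel \<and>
     (\<forall>C\<in>\<P>. \<forall>x\<in>C. \<forall>y\<in>C. dist x y < e)"

lemma fine_borel_partitionD:
  assumes "fine_borel_partition B e \<P>"
  shows "finite \<P>" "\<Union>\<P> = B" "disjoint \<P>"
    and "C \<in> \<P> \<Longrightarrow> C \<in> sets borel" "C \<in> \<P> \<Longrightarrow> C \<noteq> {}" "C \<in> \<P> \<Longrightarrow> C \<subseteq> B"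
    and "C \<in> \<P> \<Longrightarrow> x \<in> C \<Longrightarrow> y \<in> C \<Longrightarrow> dist x y < e"
  using assms unfolding fine_borel_partition_def partition_on_def by auto

lemma bounded_cell:
  assumes "bounded B" "fine_borel_partition B e \<P>" "C \<in> \<P>"
  shows "bounded C"
  using bounded_subset[OF assms(1)] fine_borel_partitionD(6)[OF assms(2,3)] .

lemma ex_fine_borel_partition:
  fixes B :: "'a::euclidean_space set"
  assumes "compact B" "e > 0"
  shows "\<exists>\<P>. fine_borel_partition B e \<P>"
proof -
  obtain F where cover: "finite F" "B \<subseteq> (\<Union>c\<in>F. ball c (e / 2))"
    using seq_compact_imp_totally_bounded assms unfolding compact_eq_seq_compact_metric
    by (metis half_gt_zero)
  define cell where "cell x = {y \<in> B. \<forall>c\<in>F. dist c y < e / 2 \<longleftrightarrow> dist c x < e / 2}" for x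
  have "cell x \<in> (\<lambda>G. {y \<in> B. \<forall>c\<in>F. dist c y < e / 2 \<longleftrightarrow> c \<in> G}) ` Pow F" for x
    unfolding cell_def by (rule image_eqI[where x = "{c \<in> F. dist c x < e / 2}"]) auto
  then have "finite (cell ` B)"
    using cover(1) by (meson finite_Pow_iff finite_imageI finite_subset image_subsetI)
  moreover have "partition_on B (cell ` B)"
    by (rule partition_onI) (auto simp: cell_def disjnt_def)
  moreover have "cell x \<in> sets borel" for x
  proof -
    have [measurable]: "B \<in> sets borel" using assms(1) by (simp add: borel_compact)
    have "{y \<in> space borel. y \<in> B \<and> (\<forall>c\<in>F. dist c y < e / 2 \<longleftrightarrow> dist c x < e / 2)} \<in> sets borel"
      using cover(1) by measurable
    then show ?thesis by (simp add: cell_def)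
  qed
  moreover have "dist y y' < e" if "x \<in> B" "y \<in> cell x" "y' \<in> cell x" for x y y'
  proof -
    obtain c where "c \<in> F" "dist c x < e / 2" using cover(2) \<open>x \<in> B\<close> by auto
    then have "dist c y < e / 2" "dist c y' < e / 2" using that by (auto simp: cell_def)
    then show ?thesis using dist_triangle3[of y y' c] by simp
  qed
  ultimately have "fine_borel_partition B e (cell ` B)"
    unfolding fine_borel_partition_def by blast
  then show ?thesis ..
qed

lemma ex_refining_partitions:
  fixes B :: "'a::euclidean_space set"
  assumes "compact B"
  obtains e \<P> where "\<And>n. fine_borel_partition B (e n) (\<P> n)" "e \<longlonglongrightarrow> 0"
proof -
  have "\<exists>\<P>. fine_borel_partition B (1 / real (Suc n)) \<P>" for n
    using assms by (intro ex_fine_borel_partition) auto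
  then obtain \<P> where "\<And>n. fine_borel_partition B (1 / real (Suc n)) (\<P> n)" by metis
  moreover have "(\<lambda>n. 1 / real (Suc n)) \<longlonglongrightarrow> 0" by (rule LIMSEQ_Suc[OF lim_1_over_n])
  ultimately show ?thesis by (rule that)
qed

text \<open>A cell of volume \<open>0\<close> gets the Dirac measure at one of its points, so that \<open>cell_measure C\<close>
  is always a probability measure.\<close>

definition cell_measure :: "'a::euclidean_space set \<Rightarrow> 'a measure" where
  "cell_measure C =
     (if emeasure lborel C \<in> {0, \<infinity>} then return borel (SOME x. x \<in> C) else uniform_measure lborel C)"

lemma sets_cell_measure [measurable_cong, simp]: "sets (cell_measure C) = sets borel"
  by (simp add: cell_measure_def)

lemma prob_space_cell_measure: "prob_space (cell_measure C)"
  by (auto simp: cell_measure_def intro!: prob_space_return prob_space_uniform_measure)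

lemma emeasure_lborel_eq_measure:
  assumes "bounded A"
  shows "emeasure lborel A = ennreal (measure lborel A)"
  using emeasure_bounded_finite[OF assms] by (simp add: emeasure_eq_ennreal_measure top.not_eq_extremum)

lemma AE_cell_measure:
  assumes "C \<in> sets borel" "C \<noteq> {}"
  shows "AE x in cell_measure C. x \<in> C"
proof (cases "emeasure lborel C \<in> {0, \<infinity>}")
  case True
  have "(SOME x. x \<in> C) \<in> C" using assms(2) by (simp add: some_in_eq)
  then show ?thesis
    unfolding cell_measure_def if_P[OF True] using assms(1) by (subst AE_return) auto
next
  case False
  show ?thesis
    unfolding cell_measure_def if_not_P[OF False] using assms(1) by (intro AE_uniform_measureI) auto
qed

lemma density_cell_measure:
  assumes "bounded C" "C \<in> sets borel"
  shows "density (cell_measure C) (\<lambda>_. ennreal (measure lborel C)) = density lborel (indicator C)"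
proof (cases "emeasure lborel C = 0")
  case True
  then have "AE x in lborel. x \<notin> C"
    using assms(2) by (intro AE_not_in) (auto simp: null_sets_def)
  then have "density lborel (indicator C) = density lborel (\<lambda>_::'a. 0)"
    using assms(2) by (intro density_cong) (auto simp: indicator_def)
  then show ?thesis
    using True by (intro measure_eqI) (auto simp: measure_def emeasure_density)
next
  case False
  let ?v = "emeasure lborel C"
  have finite_volume: "?v \<noteq> \<infinity>" using emeasure_bounded_finite[OF assms(1)] by simp
  have "density (cell_measure C) (\<lambda>_. ennreal (measure lborel C)) =
      density lborel (\<lambda>x. indicator C x / ?v * ?v)"
    using False finite_volume assms unfolding emeasure_lborel_eq_measure[OF assms(1), symmetric]
    by (simp add: cell_measure_def uniform_measure_def density_density_eq)
  also have "\<dots> = density lborel (indicator C)"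
    using False finite_volume assms(2)
    by (intro density_cong) (auto simp: ennreal_divide_times indicator_def ennreal_divide_self less_top)
  finally show ?thesis .
qed

lemma
  fixes f :: "'a::euclidean_space \<Rightarrow> real"
  assumes "bounded C" "C \<in> sets borel" and f: "f \<in> borel_measurable borel"
  shows integrable_cell_measure:
      "integrable (cell_measure C) (\<lambda>x. measure lborel C * f x) \<longleftrightarrow> set_integrable lborel C f"
    and integral_cell_measure:
      "(\<integral>x. measure lborel C * f x \<partial>cell_measure C) = (LINT x:C|lborel. f x)"
proof -
  have density: "density (cell_measure C) (\<lambda>_. ennreal (measure lborel C)) =
      density lborel (\<lambda>x. ennreal (indicator C x))"
    using density_cell_measure[OF assms(1,2)] by (simp add: ennreal_indicator)
  show "integrable (cell_measure C) (\<lambda>x. measure lborel C * f x) \<longleftrightarrow> set_integrable lborel C f"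
    using f assms(2) integrable_density[of f "cell_measure C" "\<lambda>_. measure lborel C"]
      integrable_density[of f lborel "indicator C"]
    unfolding density set_integrable_def by simp
  show "(\<integral>x. measure lborel C * f x \<partial>cell_measure C) = (LINT x:C|lborel. f x)"
    using f assms(2) integral_density[of f "cell_measure C" "\<lambda>_. measure lborel C"]
      integral_density[of f lborel "indicator C"]
    unfolding density set_lebesgue_integral_def by simp
qed

lemma PiM_density:
  assumes "finite I" and M: "\<And>i. sigma_finite_measure (M i)"
    and f [measurable]: "\<And>i. f i \<in> borel_measurable (M i)"
    and D: "\<And>i. sigma_finite_measure (density (M i) (f i))"
  shows "PiM I (\<lambda>i. density (M i) (f i)) = density (PiM I M) (\<lambda>x. \<Prod>i\<in>I. f i (x i))"
proof -
  interpret M: product_sigma_finite M by (intro product_sigma_finite.intro M)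
  interpret D: product_sigma_finite "\<lambda>i. density (M i) (f i)"
    by (intro product_sigma_finite.intro D)
  have measurable_prod: "(\<lambda>x. \<Prod>i\<in>I. f i (x i)) \<in> borel_measurable (PiM I M)"
    by measurable
  show ?thesis
  proof (rule D.PiM_eqI[symmetric, OF assms(1)])
    show "sets (density (PiM I M) (\<lambda>x. \<Prod>i\<in>I. f i (x i))) = sets (PiM I (\<lambda>i. density (M i) (f i)))"
      unfolding sets_density by (intro sets_PiM_cong) auto
    fix A assume "\<And>i. i \<in> I \<Longrightarrow> A i \<in> sets (density (M i) (f i))"
    then have A: "\<And>i. i \<in> I \<Longrightarrow> A i \<in> sets (M i)" by simp
    have "emeasure (density (PiM I M) (\<lambda>x. \<Prod>i\<in>I. f i (x i))) (Pi\<^sub>E I A) =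
        (\<integral>\<^sup>+ x. (\<Prod>i\<in>I. f i (x i)) * indicator (Pi\<^sub>E I A) x \<partial>PiM I M)"
      using A assms(1) measurable_prod by (intro emeasure_density sets_PiM_I_finite) auto
    also have "\<dots> = (\<integral>\<^sup>+ x. (\<Prod>i\<in>I. f i (x i) * indicator (A i) (x i)) \<partial>PiM I M)"
    proof (rule nn_integral_cong)
      fix x assume "x \<in> space (PiM I M)"
      then have "x \<in> extensional I" by (auto simp: space_PiM PiE_def)
      then have "indicator (Pi\<^sub>E I A) x = (\<Prod>i\<in>I. indicator (A i) (x i) :: ennreal)"
        using assms(1) by (auto simp: indicator_def PiE_iff prod_zero_iff)
      then show "(\<Prod>i\<in>I. f i (x i)) * indicator (Pi\<^sub>E I A) x = (\<Prod>i\<in>I. f i (x i) * indicator (A i) (x i))"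
        by (simp add: prod.distrib)
    qed
    also have "\<dots> = (\<Prod>i\<in>I. \<integral>\<^sup>+ y. f i y * indicator (A i) y \<partial>M i)"
      using A assms(1) by (intro M.product_nn_integral_prod) auto
    also have "\<dots> = (\<Prod>i\<in>I. emeasure (density (M i) (f i)) (A i))"
      using A by (intro prod.cong refl emeasure_density[symmetric]) auto
    finally show "emeasure (density (PiM I M) (\<lambda>x. \<Prod>i\<in>I. f i (x i))) (Pi\<^sub>E I A) =
      (\<Prod>i\<in>I. emeasure (density (M i) (f i)) (A i))" .
  qed
qed

lemma density_PiM_cell_measure:
  fixes A :: "'i \<Rightarrow> 'a::euclidean_space set"
  assumes "finite I" and A: "\<And>i. bounded (A i)" "\<And>i. A i \<in> sets borel"
  shows "density (PiM I (\<lambda>i. cell_measure (A i))) (\<lambda>_. \<Prod>i\<in>I. ennreal (measure lborel (A i))) =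
    density (PiM I (\<lambda>_. lborel)) (\<lambda>x. \<Prod>i\<in>I. indicator (A i) (x i))"
proof -
  let ?ind = "\<lambda>i. indicator (A i) :: 'a \<Rightarrow> ennreal"
  have "finite_measure (density lborel (?ind i))" for i
    using emeasure_bounded_finite[OF A(1), of i] A(2)[of i]
    by (intro finite_measureI) (simp add: emeasure_density nn_integral_indicator less_top)
  then have sigma_finite: "sigma_finite_measure (density lborel (?ind i))" for i
    by (simp add: finite_measure.axioms)
  have "PiM I (\<lambda>i. density lborel (?ind i)) = density (PiM I (\<lambda>_. lborel)) (\<lambda>x. \<Prod>i\<in>I. ?ind i (x i))"
    using A(2) sigma_finite by (intro PiM_density[OF assms(1)]) (auto simp: sigma_finite_lborel)
  moreover have "PiM I (\<lambda>i. density (cell_measure (A i)) (\<lambda>_. ennreal (measure lborel (A i)))) =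
      density (PiM I (\<lambda>i. cell_measure (A i))) (\<lambda>_. \<Prod>i\<in>I. ennreal (measure lborel (A i)))"
    using sigma_finite
    by (intro PiM_density[OF assms(1)])
      (auto simp: density_cell_measure[OF A] prob_space_cell_measure prob_space_imp_sigma_finite)
  ultimately show ?thesis by (simp add: density_cell_measure[OF A])
qed

lemma nn_integral_PiM_reindex:
  assumes "\<And>k. k \<in> J \<Longrightarrow> prob_space (M k)" "inj_on f I" "f \<in> I \<rightarrow> J"
    and g: "g \<in> borel_measurable (PiM I (\<lambda>i. M (f i)))"
  shows "(\<integral>\<^sup>+ x. g x \<partial>PiM I (\<lambda>i. M (f i))) = (\<integral>\<^sup>+ x. g (\<lambda>i\<in>I. x (f i)) \<partial>PiM J M)"
proof -
  let ?N = "PiM I (\<lambda>i. M (f i))"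
  have "(\<lambda>x. \<lambda>i\<in>I. x (f i)) \<in> measurable (PiM J M) ?N"
    using assms(3) by (intro measurable_restrict measurable_component_singleton) auto
  then have "(\<integral>\<^sup>+ x. g x \<partial>distr (PiM J M) ?N (\<lambda>x. \<lambda>i\<in>I. x (f i))) =
      (\<integral>\<^sup>+ x. g (\<lambda>i\<in>I. x (f i)) \<partial>PiM J M)"
    using g by (intro nn_integral_distr) auto
  moreover have "distr (PiM J M) ?N (\<lambda>x. \<lambda>i\<in>I. x (f i)) = ?N"
    using assms(1-3) by (rule distr_PiM_reindex)
  ultimately show ?thesis by simp
qed

section \<open>Determinantal point processes with a contractive kernel\<close>

lemma kernel_det_eq_det_on: "kernel_det K k x = det_on {..<k} (\<lambda>i j. K (x i) (x j))"
  by (simp add: kernel_det_def det_on_def)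

lemma borel_measurable_det_on:
  fixes A :: "'a \<Rightarrow> 'i \<Rightarrow> 'i \<Rightarrow> real"
  assumes "\<And>i j. i \<in> I \<Longrightarrow> j \<in> I \<Longrightarrow> (\<lambda>x. A x i j) \<in> borel_measurable N"
  shows "(\<lambda>x. det_on I (A x)) \<in> borel_measurable N"
  unfolding det_on_def
  by (intro borel_measurable_sum borel_measurable_times borel_measurable_const borel_measurable_prod)
     (auto intro!: assms simp: permutes_in_image)

text \<open>By Schur's test, the last assumption makes \<open>K\<close> a contraction on \<open>L\<^sup>2\<close>.\<close>

locale contractive_dpp =
  fixes M :: "'b measure" and X :: "'b \<Rightarrow> 'a::euclidean_space set" and K :: "'a \<Rightarrow> 'a \<Rightarrow> real"
  assumes dpp: "is_DPP M X K"
    and continuous_K: "continuous_on UNIV (\<lambda>(x, y). K x y)"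
    and psd_K: "finite F \<Longrightarrow> psd_on F K"
    and nn_integral_K_le: "(\<integral>\<^sup>+ y. ennreal \<bar>K x y\<bar> \<partial>lborel) \<le> 1"
begin

sublocale prob_space M
  using dpp by (simp add: is_DPP_def point_process_def)

definition intensity :: "'a set \<Rightarrow> real" where
  "intensity A = (LINT x:A|lborel. K x x)"

definition cell_matrix :: "('a set \<Rightarrow> 'a) \<Rightarrow> 'a set \<Rightarrow> 'a set \<Rightarrow> real" where
  "cell_matrix x C D = sqrt (measure lborel C) * sqrt (measure lborel D) * K (x C) (x D)"

definition identity_plus_cell_matrix :: "real \<Rightarrow> ('a set \<Rightarrow> 'a) \<Rightarrow> 'a set \<Rightarrow> 'a set \<Rightarrow> real" where
  "identity_plus_cell_matrix z x C D = of_bool (C = D) + z * cell_matrix x C D"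

definition cell_prod :: "real \<Rightarrow> 'a set set \<Rightarrow> 'b \<Rightarrow> real" where
  "cell_prod z \<P> \<omega> = (\<Prod>C\<in>\<P>. 1 + z * real (pcount X C \<omega>))"

lemma finite_points: "\<omega> \<in> space M \<Longrightarrow> bounded A \<Longrightarrow> finite (X \<omega> \<inter> A)"
  using dpp by (simp add: is_DPP_def point_process_def)

lemma measurable_pcount [measurable]: "A \<in> sets borel \<Longrightarrow> pcount X A \<in> measurable M (count_space UNIV)"
  using dpp by (simp add: is_DPP_def point_process_def)

lemma measurable_K [measurable (raw)]:
  assumes "f \<in> borel_measurable N" "g \<in> borel_measurable N"
  shows "(\<lambda>x. K (f x) (g x)) \<in> borel_measurable N"
proof -
  have "(\<lambda>(x, y). K x y) \<in> borel_measurable (borel \<Otimes>\<^sub>M borel)"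
    unfolding borel_prod using continuous_K by (rule borel_measurable_continuous_onI)
  from measurable_compose[OF measurable_Pair[OF assms] this] show ?thesis by simp
qed

lemma measurable_K_PiM:
  assumes "i \<in> I" "j \<in> I" "\<And>i. i \<in> I \<Longrightarrow> sets (N i) = sets borel"
  shows "(\<lambda>x. K (x i) (x j)) \<in> borel_measurable (PiM I N)"
proof -
  have "(\<lambda>x. x k) \<in> measurable (PiM I N) borel" if "k \<in> I" for k
    using measurable_component_singleton[OF that, of N] measurable_cong_sets[OF refl assms(3)[OF that]]
    by blast
  with assms(1,2) show ?thesis by measurable
qed

lemma set_integrable_K_diag:
  assumes "bounded A" "A \<in> sets borel"
  shows "set_integrable lborel A (\<lambda>x. K x x)"
proof (rule set_integrable_subset)
  have "continuous_on (closure A) (\<lambda>x. (\<lambda>(x, y). K x y) (x, x))"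
    by (intro continuous_on_compose2[OF continuous_K] continuous_intros) auto
  then show "set_integrable lborel (closure A) (\<lambda>x. K x x)"
    using borel_integrable_compact[of "closure A" "\<lambda>x. K x x"] assms(1)
    by (simp add: set_integrable_def)
qed (use assms closure_subset in auto)

lemma
  assumes "bounded C" "C \<in> sets borel"
  shows integrable_cell_diag: "integrable (cell_measure C) (\<lambda>x. measure lborel C * K x x)"
    and integral_cell_diag: "(\<integral>x. measure lborel C * K x x \<partial>cell_measure C) = intensity C"
proof -
  have measurable_diag: "(\<lambda>x. K x x) \<in> borel_measurable borel" by measurable
  show "integrable (cell_measure C) (\<lambda>x. measure lborel C * K x x)"
    unfolding integrable_cell_measure[OF assms measurable_diag] by (rule set_integrable_K_diag[OF assms])
  show "(\<integral>x. measure lborel C * K x x \<partial>cell_measure C) = intensity C"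
    unfolding intensity_def by (rule integral_cell_measure[OF assms measurable_diag])
qed

lemma sum_intensity:
  assumes "bounded B" "fine_borel_partition B e \<P>"
  shows "(\<Sum>C\<in>\<P>. intensity C) = intensity B"
proof -
  note \<P> = fine_borel_partitionD[OF assms(2)]
  have "(LINT x:(\<Union>C\<in>\<P>. C)|lborel. K x x) = (\<Sum>C\<in>\<P>. LINT x:C|lborel. K x x)"
    using \<P>(1,3,4) bounded_cell[OF assms]
    by (intro set_integral_finite_Union set_integrable_K_diag)
      (auto simp: disjoint_image_disjoint_family_on)
  then show ?thesis by (simp add: intensity_def \<P>(2))
qed

lemma psd_on_cell_matrix:
  assumes "finite \<S>"
  shows "psd_on \<S> (cell_matrix x)"
  unfolding cell_matrix_def[abs_def]
  by (rule psd_on_scale[OF psd_on_image[OF assms psd_K[OF finite_imageI[OF assms]]]])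

lemma det_on_cell_matrix:
  "det_on \<S> (cell_matrix x) = (\<Prod>C\<in>\<S>. measure lborel C) * det_on \<S> (\<lambda>C D. K (x C) (x D))"
  unfolding cell_matrix_def det_on_scale by simp

lemma kernel_det_enumeration:
  assumes bij: "bij_betw f {..<k} \<S>" and "finite \<S>"
  shows "(\<Prod>i<k. measure lborel (f i)) * kernel_det K k (\<lambda>i\<in>{..<k}. x (f i)) = det_on \<S> (cell_matrix x)"
proof -
  have "kernel_det K k (\<lambda>i\<in>{..<k}. x (f i)) = det_on {..<k} (\<lambda>i j. K (x (f i)) (x (f j)))"
    unfolding kernel_det_eq_det_on by (rule det_on_cong) simp
  also have "\<dots> = det_on \<S> (\<lambda>C D. K (x C) (x D))"
    by (rule det_on_reindex[OF bij \<open>finite \<S>\<close>, symmetric])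
  finally show ?thesis
    by (simp add: det_on_cell_matrix prod.reindex_bij_betw[OF bij, symmetric])
qed

lemma nn_integral_prod_pcount:
  fixes A :: "nat \<Rightarrow> 'a set"
  assumes A: "\<And>i. bounded (A i)" "\<And>i. A i \<in> sets borel" and disjoint: "disjoint_family_on A {..<k}"
  shows "(\<integral>\<^sup>+ \<omega>. ennreal (\<Prod>i<k. real (pcount X (A i) \<omega>)) \<partial>M) =
    (\<integral>\<^sup>+ x. ennreal ((\<Prod>i<k. measure lborel (A i)) * kernel_det K k x)
      \<partial>PiM {..<k} (\<lambda>i. cell_measure (A i)))"
proof (cases "k = 0")
  case True
  then show ?thesis
    by (simp add: PiM_empty kernel_det_eq_det_on emeasure_space_1 nn_integral_count_space_finite)
next
  case False
  let ?L = "PiM {..<k} (\<lambda>_. lborel :: 'a measure)" and ?C = "PiM {..<k} (\<lambda>i. cell_measure (A i))"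
  let ?d = "\<lambda>x. ennreal (kernel_det K k x)"
  have measurable_d: "?d \<in> borel_measurable (PiM {..<k} N)" if "\<And>i. sets (N i) = sets borel" for N
    unfolding kernel_det_eq_det_on
    by (intro measurable_compose[OF _ measurable_ennreal] borel_measurable_det_on measurable_K_PiM)
      (auto simp: that)
  have "(\<integral>\<^sup>+ \<omega>. ennreal (\<Prod>i<k. real (pcount X (A i) \<omega>)) \<partial>M) =
      (\<integral>\<^sup>+ x. ennreal ((\<Prod>i<k. indicator (A i) (x i)) * kernel_det K k x) \<partial>?L)"
    using dpp False A disjoint
    unfolding is_DPP_def has_correlation_functions_def disjoint_family_on_def
    by (simp add: prod_ennreal)
  also have "\<dots> = (\<integral>\<^sup>+ x. (\<Prod>i<k. indicator (A i) (x i)) * ?d x \<partial>?L)"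
    by (intro nn_integral_cong)
      (simp add: ennreal_mult' prod_nonneg prod_ennreal[symmetric] ennreal_indicator)
  also have "\<dots> = (\<integral>\<^sup>+ x. ?d x \<partial>density ?L (\<lambda>x. \<Prod>i<k. indicator (A i) (x i)))"
    using A(2) measurable_d by (intro nn_integral_density[symmetric]) auto
  also have "\<dots> = (\<integral>\<^sup>+ x. ?d x \<partial>density ?C (\<lambda>_. \<Prod>i<k. ennreal (measure lborel (A i))))"
    by (simp add: density_PiM_cell_measure A)
  also have "\<dots> = (\<integral>\<^sup>+ x. (\<Prod>i<k. ennreal (measure lborel (A i))) * ?d x \<partial>?C)"
    using measurable_d by (intro nn_integral_density) auto
  finally show ?thesis
    by (simp add: prod_ennreal ennreal_mult' prod_nonneg)
qed

lemma nn_integral_prod_pcount_cells: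
  assumes "bounded B" "fine_borel_partition B e \<P>" "\<S> \<subseteq> \<P>"
  shows "(\<integral>\<^sup>+ \<omega>. ennreal (\<Prod>C\<in>\<S>. real (pcount X C \<omega>)) \<partial>M) =
    (\<integral>\<^sup>+ x. ennreal (det_on \<S> (cell_matrix x)) \<partial>PiM \<P> cell_measure)"
proof (cases "\<S> = {}")
  case True
  interpret cells: prob_space "PiM \<P> cell_measure"
    by (intro prob_space_PiM prob_space_cell_measure)
  show ?thesis using True by (simp add: emeasure_space_1 cells.emeasure_space_1)
next
  case False
  note \<P> = fine_borel_partitionD[OF assms(2)]
  have "finite \<S>" using \<P>(1) assms(3) finite_subset by blast
  define k f where "k = card \<S>" and "f = from_nat_into \<S>"
  have bij: "bij_betw f {..<k} \<S>"
    unfolding f_def k_def using \<open>finite \<S>\<close> by (rule bij_betw_from_nat_into_finite)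
  have f_in: "f i \<in> \<P>" for i
    using from_nat_into[OF False] assms(3) by (auto simp: f_def)
  let ?C = "PiM {..<k} (\<lambda>i. cell_measure (f i))"
  let ?g = "\<lambda>x. ennreal ((\<Prod>i<k. measure lborel (f i)) * kernel_det K k x)"
  have measurable_g: "?g \<in> borel_measurable ?C"
    unfolding kernel_det_eq_det_on
    by (intro measurable_compose[OF _ measurable_ennreal] borel_measurable_times borel_measurable_const
        borel_measurable_det_on measurable_K_PiM) auto
  have "(\<integral>\<^sup>+ \<omega>. ennreal (\<Prod>C\<in>\<S>. real (pcount X C \<omega>)) \<partial>M) =
      (\<integral>\<^sup>+ \<omega>. ennreal (\<Prod>i<k. real (pcount X (f i) \<omega>)) \<partial>M)"
    by (simp add: prod.reindex_bij_betw[OF bij, symmetric])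
  also have "\<dots> = (\<integral>\<^sup>+ x. ?g x \<partial>?C)"
  proof (rule nn_integral_prod_pcount)
    show "bounded (f i)" "f i \<in> sets borel" for i
      using \<P>(4)[OF f_in] bounded_cell[OF assms(1,2) f_in] by auto
    show "disjoint_family_on f {..<k}"
      using bij pairwise_subset[OF \<P>(3) assms(3)]
      by (intro disjoint_image_disjoint_family_on) (auto simp: bij_betw_def)
  qed
  also have "\<dots> = (\<integral>\<^sup>+ x. ?g (\<lambda>i\<in>{..<k}. x (f i)) \<partial>PiM \<P> cell_measure)"
    using bij f_in measurable_g
    by (intro nn_integral_PiM_reindex prob_space_cell_measure) (auto simp: bij_betw_def)
  also have "\<dots> = (\<integral>\<^sup>+ x. ennreal (det_on \<S> (cell_matrix x)) \<partial>PiM \<P> cell_measure)"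
    by (simp only: kernel_det_enumeration[OF bij \<open>finite \<S>\<close>])
  finally show ?thesis .
qed

lemma integrable_det_on_cell_matrix:
  assumes "bounded B" "fine_borel_partition B e \<P>" "\<S> \<subseteq> \<P>"
  shows "integrable (PiM \<P> cell_measure) (\<lambda>x. det_on \<S> (cell_matrix x))"
proof -
  note \<P> = fine_borel_partitionD[OF assms(2)]
  interpret cells: product_prob_space cell_measure \<P>
    by (intro product_prob_spaceI prob_space_cell_measure)
  have "finite \<S>" using \<P>(1) assms(3) finite_subset by blast
  define d where "d C y = (if C \<in> \<S> then measure lborel C * K y y else 1)" for C y
  have "integrable (cell_measure C) (d C)" if "C \<in> \<P>" for C
    unfolding d_def using integrable_cell_diag \<P>(4)[OF that] bounded_cell[OF assms(1,2) that]
    by (cases "C \<in> \<S>") auto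
  then have majorant: "integrable (PiM \<P> cell_measure) (\<lambda>x. \<Prod>C\<in>\<P>. d C (x C))"
    using \<P>(1) by (intro cells.product_integrable_prod)
  have "(\<Prod>C\<in>\<P>. d C (x C)) = (\<Prod>C\<in>\<S>. cell_matrix x C C)" for x
    using \<P>(1) assms(3) by (intro prod.mono_neutral_cong_right) (auto simp: d_def cell_matrix_def)
  then have "\<bar>det_on \<S> (cell_matrix x)\<bar> \<le> \<bar>\<Prod>C\<in>\<P>. d C (x C)\<bar>" for x
    using det_on_nonneg[OF \<open>finite \<S>\<close> psd_on_cell_matrix[OF \<open>finite \<S>\<close>]]
      hadamard_inequality[OF \<open>finite \<S>\<close> psd_on_cell_matrix[OF \<open>finite \<S>\<close>], of x]
    by simp
  moreover have "(\<lambda>x. det_on \<S> (cell_matrix x)) \<in> borel_measurable (PiM \<P> cell_measure)"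
    unfolding det_on_cell_matrix using assms(3)
    by (intro borel_measurable_times borel_measurable_const borel_measurable_det_on measurable_K_PiM)
      auto
  ultimately show ?thesis
    by (intro Bochner_Integration.integrable_bound[OF majorant]) auto
qed

lemma
  assumes "bounded B" "fine_borel_partition B e \<P>" "\<S> \<subseteq> \<P>"
  shows integrable_prod_pcount: "integrable M (\<lambda>\<omega>. \<Prod>C\<in>\<S>. real (pcount X C \<omega>))"
    and expectation_prod_pcount: "expectation (\<lambda>\<omega>. \<Prod>C\<in>\<S>. real (pcount X C \<omega>)) =
      (\<integral>x. det_on \<S> (cell_matrix x) \<partial>PiM \<P> cell_measure)"
proof -
  note \<P> = fine_borel_partitionD[OF assms(2)]
  have "finite \<S>" using \<P>(1) assms(3) finite_subset by blast
  then have det_nonneg: "0 \<le> det_on \<S> (cell_matrix x)" for x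
    by (intro det_on_nonneg psd_on_cell_matrix)
  have [measurable]: "(\<lambda>\<omega>. \<Prod>C\<in>\<S>. real (pcount X C \<omega>)) \<in> borel_measurable M"
    using assms(3) \<P>(4) by (intro borel_measurable_prod) auto
  note nn_integral_pcount = nn_integral_prod_pcount_cells[OF assms]
    and integrable_det = integrable_det_on_cell_matrix[OF assms]
  show "integrable M (\<lambda>\<omega>. \<Prod>C\<in>\<S>. real (pcount X C \<omega>))"
    using nn_integral_eq_integral[OF integrable_det] det_nonneg
    by (intro integrableI_nonneg) (auto simp: nn_integral_pcount prod_nonneg)
  show "expectation (\<lambda>\<omega>. \<Prod>C\<in>\<S>. real (pcount X C \<omega>)) =
      (\<integral>x. det_on \<S> (cell_matrix x) \<partial>PiM \<P> cell_measure)"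
    using det_nonneg borel_measurable_integrable[OF integrable_det]
    by (simp add: integral_eq_nn_integral prod_nonneg nn_integral_pcount)
qed

lemma
  assumes "bounded B" "fine_borel_partition B e \<P>"
  shows integrable_cell_prod: "integrable M (cell_prod z \<P>)"
    and integrable_det_on_identity_plus_cell_matrix:
      "integrable (PiM \<P> cell_measure) (\<lambda>x. det_on \<P> (identity_plus_cell_matrix z x))"
    and expectation_cell_prod: "expectation (cell_prod z \<P>) =
      (\<integral>x. det_on \<P> (identity_plus_cell_matrix z x) \<partial>PiM \<P> cell_measure)"
proof -
  have "finite \<P>" by (rule fine_borel_partitionD[OF assms(2)])
  have prod_expansion: "cell_prod z \<P> =
      (\<lambda>\<omega>. \<Sum>\<S>\<in>Pow \<P>. z ^ card \<S> * (\<Prod>C\<in>\<S>. real (pcount X C \<omega>)))"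
    using prod_add[OF \<open>finite \<P>\<close>, of "\<lambda>C. z * real (pcount X C _)" "\<lambda>_. 1"]
    by (simp add: fun_eq_iff cell_prod_def prod.distrib add.commute)
  have det_expansion: "det_on \<P> (identity_plus_cell_matrix z x) =
      (\<Sum>\<S>\<in>Pow \<P>. z ^ card \<S> * det_on \<S> (cell_matrix x))" for x
    using det_on_scale[of _ "\<lambda>_. z" "\<lambda>_. 1" "cell_matrix x"]
    by (simp add: identity_plus_cell_matrix_def[abs_def] det_on_identity_plus[OF \<open>finite \<P>\<close>])
  note subset_facts = integrable_prod_pcount[OF assms] integrable_det_on_cell_matrix[OF assms]
  show "integrable M (cell_prod z \<P>)"
    unfolding prod_expansion using subset_facts by (intro Bochner_Integration.integrable_sum) auto
  show "integrable (PiM \<P> cell_measure) (\<lambda>x. det_on \<P> (identity_plus_cell_matrix z x))"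
    unfolding det_expansion using subset_facts by (intro Bochner_Integration.integrable_sum) auto
  have "expectation (cell_prod z \<P>) =
      (\<Sum>\<S>\<in>Pow \<P>. z ^ card \<S> * expectation (\<lambda>\<omega>. \<Prod>C\<in>\<S>. real (pcount X C \<omega>)))"
    unfolding prod_expansion using subset_facts by (subst Bochner_Integration.integral_sum) auto
  also have "\<dots> = (\<Sum>\<S>\<in>Pow \<P>. z ^ card \<S> * (\<integral>x. det_on \<S> (cell_matrix x) \<partial>PiM \<P> cell_measure))"
    by (intro sum.cong refl) (simp add: expectation_prod_pcount[OF assms])
  also have "\<dots> = (\<integral>x. det_on \<P> (identity_plus_cell_matrix z x) \<partial>PiM \<P> cell_measure)"
    unfolding det_expansion using subset_facts by (subst Bochner_Integration.integral_sum) auto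
  finally show "expectation (cell_prod z \<P>) =
      (\<integral>x. det_on \<P> (identity_plus_cell_matrix z x) \<partial>PiM \<P> cell_measure)" .
qed

end

section \<open>The generating function of the number of points\<close>

context contractive_dpp
begin

definition psd_samples :: "real \<Rightarrow> 'a set set \<Rightarrow> bool" where
  "psd_samples z \<P> \<longleftrightarrow> (\<forall>x. (\<forall>C\<in>\<P>. x C \<in> C) \<longrightarrow> psd_on \<P> (identity_plus_cell_matrix z x))"

lemma psd_samplesD:
  "psd_samples z \<P> \<Longrightarrow> (\<And>C. C \<in> \<P> \<Longrightarrow> x C \<in> C) \<Longrightarrow> psd_on \<P> (identity_plus_cell_matrix z x)"
  unfolding psd_samples_def by blast

lemma abs_K_cell_le:
  assumes "bounded C" and [measurable]: "C \<in> sets borel"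
    and oscillation: "\<And>y. y \<in> C \<Longrightarrow> \<bar>K u v\<bar> \<le> \<bar>K u y\<bar> + \<eta>"
  shows "ennreal (\<bar>K u v\<bar> * measure lborel C) \<le> emeasure (density lborel (\<lambda>y. ennreal (\<bar>K u y\<bar> + \<eta>))) C"
proof -
  have "ennreal (\<bar>K u v\<bar> * measure lborel C) = (\<integral>\<^sup>+ y. ennreal \<bar>K u v\<bar> * indicator C y \<partial>lborel)"
    using emeasure_lborel_eq_measure[OF assms(1)]
    by (simp add: nn_integral_cmult_indicator ennreal_mult'')
  also have "\<dots> \<le> (\<integral>\<^sup>+ y. ennreal (\<bar>K u y\<bar> + \<eta>) * indicator C y \<partial>lborel)"
    using oscillation by (intro nn_integral_mono) (auto simp: indicator_def intro!: ennreal_leI)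
  also have "\<dots> = emeasure (density lborel (\<lambda>y. ennreal (\<bar>K u y\<bar> + \<eta>))) C"
    by (rule emeasure_density[symmetric]) measurable
  finally show ?thesis .
qed

lemma sum_abs_K_cells_le:
  assumes "bounded B" "fine_borel_partition B e \<P>" "0 \<le> \<eta>"
    and oscillation: "\<And>C y. C \<in> \<P> \<Longrightarrow> y \<in> C \<Longrightarrow> \<bar>K u (x C)\<bar> \<le> \<bar>K u y\<bar> + \<eta>"
  shows "(\<Sum>C\<in>\<P>. \<bar>K u (x C)\<bar> * measure lborel C) \<le> 1 + \<eta> * measure lborel B"
proof -
  note \<P> = fine_borel_partitionD[OF assms(2)]
  have [measurable]: "B \<in> sets borel"
    using \<P>(1,2,4) by (metis sets.finite_Union subsetI)
  define \<nu> where "\<nu> = density lborel (\<lambda>y. ennreal (\<bar>K u y\<bar> + \<eta>))"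
  have "ennreal (\<Sum>C\<in>\<P>. \<bar>K u (x C)\<bar> * measure lborel C) =
      (\<Sum>C\<in>\<P>. ennreal (\<bar>K u (x C)\<bar> * measure lborel C))"
    by (intro sum_ennreal[symmetric]) simp
  also have "\<dots> \<le> (\<Sum>C\<in>\<P>. emeasure \<nu> C)"
    unfolding \<nu>_def using \<P>(4) bounded_cell[OF assms(1,2)] oscillation
    by (intro sum_mono abs_K_cell_le)
  also have "\<dots> = emeasure \<nu> B"
    using \<P>(1-4) sum_emeasure[of "\<lambda>C. C" \<P> \<nu>]
    by (auto simp: \<nu>_def disjoint_image_disjoint_family_on)
  also have "\<dots> = (\<integral>\<^sup>+ y. ennreal (\<bar>K u y\<bar> + \<eta>) * indicator B y \<partial>lborel)"
    unfolding \<nu>_def by (rule emeasure_density) measurable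
  also have "\<dots> \<le> (\<integral>\<^sup>+ y. ennreal \<bar>K u y\<bar> + ennreal \<eta> * indicator B y \<partial>lborel)"
    using assms(3) by (intro nn_integral_mono) (auto simp: indicator_def)
  also have "\<dots> = (\<integral>\<^sup>+ y. ennreal \<bar>K u y\<bar> \<partial>lborel) + ennreal \<eta> * emeasure lborel B"
    by (subst nn_integral_add) (auto simp: nn_integral_cmult_indicator)
  also have "\<dots> \<le> 1 + ennreal (\<eta> * measure lborel B)"
    using nn_integral_K_le assms(3)
    by (intro add_mono) (auto simp: emeasure_lborel_eq_measure[OF assms(1)] ennreal_mult)
  also have "\<dots> = ennreal (1 + \<eta> * measure lborel B)"
    using assms(3) by simp
  finally show ?thesis
    using assms(3) by (subst (asm) ennreal_le_iff) auto
qed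

lemma psd_samplesI:
  assumes "bounded B" and part: "fine_borel_partition B e \<P>" and "0 \<le> \<eta>"
    and oscillation: "\<And>u C y y'. u \<in> B \<Longrightarrow> C \<in> \<P> \<Longrightarrow> y \<in> C \<Longrightarrow> y' \<in> C \<Longrightarrow> \<bar>K u y\<bar> \<le> \<bar>K u y'\<bar> + \<eta>"
    and spectral_bound: "0 \<le> 1 + z * (1 + \<eta> * measure lborel B)"
  shows "psd_samples z \<P>"
  unfolding psd_samples_def
proof (intro allI impI)
  fix x assume x: "\<forall>C\<in>\<P>. x C \<in> C"
  note \<P> = fine_borel_partitionD[OF part]
  have "quad_form \<P> (cell_matrix x) c \<le> (1 + \<eta> * measure lborel B) * (\<Sum>C\<in>\<P>. (c C)\<^sup>2)" for c
    unfolding cell_matrix_def[abs_def]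
  proof (rule schur_test)
    show "K (x C) (x D) = K (x D) (x C)" for C D
      using psd_on_sym[OF psd_K[of "{x C, x D}"]] by simp
    fix C assume "C \<in> \<P>"
    then have "x C \<in> B" using \<P>(6) x by blast
    then show "(\<Sum>D\<in>\<P>. \<bar>K (x C) (x D)\<bar> * (sqrt (measure lborel D))\<^sup>2) \<le> 1 + \<eta> * measure lborel B"
      using sum_abs_K_cells_le[OF assms(1) part assms(3), of "x C" x] oscillation x by simp
  qed
  then show "psd_on \<P> (identity_plus_cell_matrix z x)"
    unfolding identity_plus_cell_matrix_def[abs_def]
    by (rule psd_on_identity_plus[OF \<P>(1) psd_on_cell_matrix[OF \<P>(1)] _ spectral_bound])
qed

lemma K_uniform_oscillation:
  assumes "compact B" "0 < \<eta>"
  obtains d where "d > 0"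
    "\<And>u y y'. u \<in> B \<Longrightarrow> y \<in> B \<Longrightarrow> y' \<in> B \<Longrightarrow> dist y y' < d \<Longrightarrow> \<bar>K u y\<bar> \<le> \<bar>K u y'\<bar> + \<eta>"
proof -
  have "uniformly_continuous_on (B \<times> B) (\<lambda>(x, y). K x y)"
    using continuous_K assms(1)
    by (intro compact_uniformly_continuous compact_Times) (auto intro: continuous_on_subset)
  then obtain d where "d > 0"
    and modulus: "\<And>p q. p \<in> B \<times> B \<Longrightarrow> q \<in> B \<times> B \<Longrightarrow> dist q p < d \<Longrightarrow>
      dist (case q of (x, y) \<Rightarrow> K x y) (case p of (x, y) \<Rightarrow> K x y) < \<eta>"
    using assms(2) unfolding uniformly_continuous_on_def by metis
  have "\<bar>K u y\<bar> \<le> \<bar>K u y'\<bar> + \<eta>" if "u \<in> B" "y \<in> B" "y' \<in> B" "dist y y' < d" for u y y'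
    using modulus[of "(u, y')" "(u, y)"] that by (auto simp: dist_Pair_Pair dist_real_def)
  with \<open>d > 0\<close> show ?thesis by (rule that)
qed

lemma ex_mesh_psd_samples:
  assumes "compact B" "-1 < z"
  obtains d where "d > 0" "\<And>\<P>. fine_borel_partition B d \<P> \<Longrightarrow> psd_samples z \<P>"
proof -
  define v where "v = measure lborel B"
  define \<eta> where "\<eta> = (1 + z) / (1 + v)"
  have "0 \<le> v" by (simp add: v_def)
  then have "\<eta> > 0" using assms(2) by (simp add: \<eta>_def)
  have "\<eta> * v \<le> \<eta> * (1 + v)"
    using \<open>\<eta> > 0\<close> by (intro mult_left_mono) auto
  also have "\<dots> = 1 + z" using \<open>0 \<le> v\<close> by (simp add: \<eta>_def)
  finally have "\<eta> * v \<le> 1 + z" .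
  have spectral_bound: "0 \<le> 1 + z * (1 + \<eta> * v)"
  proof (cases "0 \<le> z")
    case False
    then have "- z * (\<eta> * v) \<le> 1 * (1 + z)"
      using assms(2) \<open>\<eta> * v \<le> 1 + z\<close> \<open>\<eta> > 0\<close> \<open>0 \<le> v\<close> by (intro mult_mono) auto
    then show ?thesis by (simp add: algebra_simps)
  qed (use \<open>\<eta> > 0\<close> \<open>0 \<le> v\<close> in simp)
  obtain d where "d > 0"
    and oscillation: "\<And>u y y'. u \<in> B \<Longrightarrow> y \<in> B \<Longrightarrow> y' \<in> B \<Longrightarrow> dist y y' < d \<Longrightarrow> \<bar>K u y\<bar> \<le> \<bar>K u y'\<bar> + \<eta>"
    using K_uniform_oscillation[OF assms(1) \<open>\<eta> > 0\<close>] by blast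
  have "psd_samples z \<P>" if part: "fine_borel_partition B d \<P>" for \<P>
  proof (rule psd_samplesI[OF compact_imp_bounded[OF assms(1)] part])
    show "0 \<le> \<eta>" using \<open>\<eta> > 0\<close> by simp
    show "0 \<le> 1 + z * (1 + \<eta> * measure lborel B)" using spectral_bound by (simp add: v_def)
    show "\<bar>K u y\<bar> \<le> \<bar>K u y'\<bar> + \<eta>" if "u \<in> B" "C \<in> \<P>" "y \<in> C" "y' \<in> C" for u C y y'
      using that fine_borel_partitionD(6,7)[OF part] by (intro oscillation) auto
  qed
  with \<open>d > 0\<close> show ?thesis by (rule that)
qed

lemma identity_plus_cell_matrix_diag:
  "identity_plus_cell_matrix z x C C = 1 + z * (measure lborel C * K (x C) (x C))"
  by (simp add: identity_plus_cell_matrix_def cell_matrix_def)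

lemma
  assumes "bounded C" "C \<in> sets borel"
  shows integrable_one_plus_cell_diag:
      "integrable (cell_measure C) (\<lambda>y. 1 + z * (measure lborel C * K y y))"
    and integral_one_plus_cell_diag:
      "(\<integral>y. 1 + z * (measure lborel C * K y y) \<partial>cell_measure C) = 1 + z * intensity C"
proof -
  interpret cell: prob_space "cell_measure C" by (rule prob_space_cell_measure)
  note diag = integrable_cell_diag[OF assms]
  show "integrable (cell_measure C) (\<lambda>y. 1 + z * (measure lborel C * K y y))"
    using diag by (intro Bochner_Integration.integrable_add integrable_mult_right) auto
  show "(\<integral>y. 1 + z * (measure lborel C * K y y) \<partial>cell_measure C) = 1 + z * intensity C"
    unfolding integral_cell_diag[OF assms, symmetric]
    using diag cell.prob_space by (subst Bochner_Integration.integral_add) auto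
qed

lemma one_plus_intensity_nonneg:
  assumes "bounded B" "fine_borel_partition B e \<P>" "psd_samples z \<P>" "C \<in> \<P>"
  shows "0 \<le> 1 + z * intensity C"
proof -
  note \<P> = fine_borel_partitionD[OF assms(2)]
  have cell: "bounded C" "C \<in> sets borel"
    using \<P>(4)[OF assms(4)] bounded_cell[OF assms(1,2,4)] by auto
  have "0 \<le> 1 + z * (measure lborel C * K y y)" if "y \<in> C" for y
  proof -
    let ?x = "\<lambda>D. if D = C then y else SOME u. u \<in> D"
    have "psd_on \<P> (identity_plus_cell_matrix z ?x)"
      using \<P>(5) that by (intro psd_samplesD[OF assms(3)]) (auto simp: some_in_eq)
    from psd_on_diag_nonneg[OF this \<P>(1) assms(4)] show ?thesis
      by (simp add: identity_plus_cell_matrix_diag)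
  qed
  then have "AE y in cell_measure C. 0 \<le> 1 + z * (measure lborel C * K y y)"
    using AE_cell_measure[OF cell(2) \<P>(5)[OF assms(4)]] by auto
  then have "0 \<le> (\<integral>y. 1 + z * (measure lborel C * K y y) \<partial>cell_measure C)"
    by (rule integral_nonneg_AE)
  then show ?thesis unfolding integral_one_plus_cell_diag[OF cell] .
qed

lemma expectation_cell_prod_le:
  assumes "bounded B" and part: "fine_borel_partition B e \<P>" and psd: "psd_samples z \<P>"
  shows "expectation (cell_prod z \<P>) \<le> exp (z * intensity B)"
proof -
  note \<P> = fine_borel_partitionD[OF part]
  interpret cells: product_prob_space cell_measure \<P>
    by (intro product_prob_spaceI prob_space_cell_measure)
  define g where "g C y = 1 + z * (measure lborel C * K y y)" for C :: "'a set" and y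
  have integrable_g: "integrable (cell_measure C) (g C)"
    and integral_g: "integral\<^sup>L (cell_measure C) (g C) = 1 + z * intensity C"
    if "C \<in> \<P>" for C
    unfolding g_def using \<P>(4)[OF that] bounded_cell[OF assms(1) part that]
    by (blast intro: integrable_one_plus_cell_diag integral_one_plus_cell_diag)+
  have "AE x in PiM \<P> cell_measure. \<forall>C\<in>\<P>. x C \<in> C"
    using \<P> by (intro AE_finite_allI AE_PiM_component AE_cell_measure prob_space_cell_measure) auto
  then have hadamard: "AE x in PiM \<P> cell_measure.
      det_on \<P> (identity_plus_cell_matrix z x) \<le> (\<Prod>C\<in>\<P>. g C (x C))"
  proof eventually_elim
    case (elim x)
    then have "psd_on \<P> (identity_plus_cell_matrix z x)" by (intro psd_samplesD[OF psd]) auto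
    from hadamard_inequality[OF \<P>(1) this] show ?case
      by (simp add: identity_plus_cell_matrix_diag g_def)
  qed
  have "expectation (cell_prod z \<P>) \<le> (\<integral>x. (\<Prod>C\<in>\<P>. g C (x C)) \<partial>PiM \<P> cell_measure)"
    unfolding expectation_cell_prod[OF assms(1,2)]
    using \<P>(1) integrable_g hadamard
    by (intro integral_mono_AE integrable_det_on_identity_plus_cell_matrix[OF assms(1,2)]
        cells.product_integrable_prod)
  also have "\<dots> = (\<Prod>C\<in>\<P>. integral\<^sup>L (cell_measure C) (g C))"
    using \<P>(1) integrable_g by (intro cells.product_integral_prod)
  also have "\<dots> = (\<Prod>C\<in>\<P>. 1 + z * intensity C)"
    by (intro prod.cong refl integral_g)
  also have "\<dots> \<le> (\<Prod>C\<in>\<P>. exp (z * intensity C))"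
    by (intro prod_mono conjI one_plus_intensity_nonneg[OF assms(1) part psd] exp_ge_add_one_self)
  also have "\<dots> = exp (z * intensity B)"
    using \<P>(1)
    by (simp add: exp_sum[symmetric] sum_distrib_left[symmetric] sum_intensity[OF assms(1) part])
  finally show ?thesis .
qed

lemma sum_pcount:
  assumes "bounded B" "fine_borel_partition B e \<P>" "\<omega> \<in> space M"
  shows "(\<Sum>C\<in>\<P>. pcount X C \<omega>) = pcount X B \<omega>"
proof -
  note \<P> = fine_borel_partitionD[OF assms(2)]
  have "X \<omega> \<inter> B = (\<Union>C\<in>\<P>. X \<omega> \<inter> C)" using \<P>(2) by blast
  moreover have "card (\<Union>C\<in>\<P>. X \<omega> \<inter> C) = (\<Sum>C\<in>\<P>. card (X \<omega> \<inter> C))"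
  proof (rule card_UN_disjoint[OF \<P>(1)])
    show "\<forall>C\<in>\<P>. finite (X \<omega> \<inter> C)"
      by (intro ballI finite_points[OF assms(3)] bounded_cell[OF assms(1,2)])
    show "\<forall>C\<in>\<P>. \<forall>D\<in>\<P>. C \<noteq> D \<longrightarrow> X \<omega> \<inter> C \<inter> (X \<omega> \<inter> D) = {}"
      using \<P>(3) by (auto simp: disjoint_def)
  qed
  ultimately show ?thesis by (simp add: pcount_def)
qed

lemma cell_prod_eq_power:
  assumes "bounded B" "fine_borel_partition B e \<P>" "\<omega> \<in> space M"
    and single: "\<And>C. C \<in> \<P> \<Longrightarrow> pcount X C \<omega> \<le> 1"
  shows "cell_prod z \<P> \<omega> = (1 + z) ^ pcount X B \<omega>"
proof -
  have "1 + z * real (pcount X C \<omega>) = (1 + z) ^ pcount X C \<omega>" if "C \<in> \<P>" for C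
    using single[OF that] by (cases "pcount X C \<omega>") auto
  then show ?thesis
    by (simp add: cell_prod_def power_sum[symmetric] sum_pcount[OF assms(1-3)])
qed

lemma abs_cell_prod_le:
  assumes "bounded B" "fine_borel_partition B e \<P>" "\<omega> \<in> space M"
  shows "\<bar>cell_prod z \<P> \<omega>\<bar> \<le> (1 + \<bar>z\<bar>) ^ pcount X B \<omega>"
proof -
  have "\<bar>1 + z * real k\<bar> \<le> (1 + \<bar>z\<bar>) ^ k" for k
  proof -
    have "\<bar>1 + z * real k\<bar> \<le> 1 + real k * \<bar>z\<bar>"
      using abs_triangle_ineq[of 1 "z * real k"] by (simp add: abs_mult mult.commute)
    also have "\<dots> \<le> (1 + \<bar>z\<bar>) ^ k" by (rule Bernoulli_inequality) simp
    finally show ?thesis .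
  qed
  then have "\<bar>cell_prod z \<P> \<omega>\<bar> \<le> (\<Prod>C\<in>\<P>. (1 + \<bar>z\<bar>) ^ pcount X C \<omega>)"
    unfolding cell_prod_def abs_prod by (intro prod_mono) auto
  then show ?thesis by (simp add: power_sum[symmetric] sum_pcount[OF assms])
qed

lemma eventually_cell_prod_eq_power:
  assumes "bounded B" and part: "\<And>n. fine_borel_partition B (e n) (\<P> n)" and "e \<longlonglongrightarrow> 0"
    and \<omega>: "\<omega> \<in> space M"
  shows "\<forall>\<^sub>F n in sequentially. cell_prod z (\<P> n) \<omega> = (1 + z) ^ pcount X B \<omega>"
proof -
  have "finite (X \<omega> \<inter> B)" by (rule finite_points[OF \<omega> assms(1)])
  then obtain d where "d > 0"
    and separated: "\<And>x y. x \<in> X \<omega> \<inter> B \<Longrightarrow> y \<in> X \<omega> \<inter> B \<Longrightarrow> dist x y < d \<Longrightarrow> x = y"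
    using uniform_discrete_finite_iff unfolding uniform_discrete_def by metis
  from order_tendstoD(2)[OF assms(3) \<open>d > 0\<close>] show ?thesis
  proof eventually_elim
    case (elim n)
    note \<P> = fine_borel_partitionD[OF part[of n]]
    show ?case
    proof (rule cell_prod_eq_power[OF assms(1) part \<omega>])
      fix C assume C: "C \<in> \<P> n"
      have "x = y" if "x \<in> X \<omega> \<inter> C" "y \<in> X \<omega> \<inter> C" for x y
        using separated[of x y] \<P>(6,7)[OF C] that elim by fastforce
      moreover have "finite (X \<omega> \<inter> C)"
        using \<open>finite (X \<omega> \<inter> B)\<close> \<P>(6)[OF C] by (meson Int_mono finite_subset order_refl)
      ultimately show "pcount X C \<omega> \<le> 1"
        unfolding pcount_def by (simp add: card_le_Suc0_iff_eq)
    qed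
  qed
qed

lemma eventually_expectation_cell_prod_le:
  assumes "compact B" "-1 < z" and part: "\<And>n. fine_borel_partition B (e n) (\<P> n)" and "e \<longlonglongrightarrow> 0"
  shows "\<forall>\<^sub>F n in sequentially. expectation (cell_prod z (\<P> n)) \<le> exp (z * intensity B)"
proof -
  obtain d where "d > 0" and psd: "\<And>\<P>. fine_borel_partition B d \<P> \<Longrightarrow> psd_samples z \<P>"
    using ex_mesh_psd_samples[OF assms(1,2)] by blast
  from order_tendstoD(2)[OF assms(4) \<open>d > 0\<close>] show ?thesis
  proof eventually_elim
    case (elim n)
    then have "fine_borel_partition B d (\<P> n)"
      using part[of n] unfolding fine_borel_partition_def by fastforce
    then show ?case
      by (intro expectation_cell_prod_le[OF compact_imp_bounded[OF assms(1)] part] psd)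
  qed
qed

lemma integrable_power_pcount_nonneg:
  fixes z :: real
  assumes "compact B" "0 \<le> z"
  shows "integrable M (\<lambda>\<omega>. (1 + z) ^ pcount X B \<omega>)"
proof -
  have bounded: "bounded B" and [measurable]: "B \<in> sets borel"
    using assms(1) by (auto simp: compact_imp_bounded borel_compact)
  obtain e \<P> where part: "\<And>n. fine_borel_partition B (e n) (\<P> n)" and e: "e \<longlonglongrightarrow> 0"
    using ex_refining_partitions[OF assms(1)] by blast
  note cell_prod = integrable_cell_prod[OF bounded part]
  have nonneg: "0 \<le> cell_prod z (\<P> n) \<omega>" for n \<omega>
    unfolding cell_prod_def using assms(2) by (intro prod_nonneg) auto
  have "(\<integral>\<^sup>+ \<omega>. ennreal ((1 + z) ^ pcount X B \<omega>) \<partial>M) =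
      (\<integral>\<^sup>+ \<omega>. liminf (\<lambda>n. ennreal (cell_prod z (\<P> n) \<omega>)) \<partial>M)"
  proof (rule nn_integral_cong)
    fix \<omega> assume "\<omega> \<in> space M"
    from eventually_cell_prod_eq_power[OF bounded part e this, of z]
    have "\<forall>\<^sub>F n in sequentially. ennreal (cell_prod z (\<P> n) \<omega>) = ennreal ((1 + z) ^ pcount X B \<omega>)"
      by (rule eventually_mono) simp
    then show "ennreal ((1 + z) ^ pcount X B \<omega>) = liminf (\<lambda>n. ennreal (cell_prod z (\<P> n) \<omega>))"
      by (intro lim_imp_Liminf[symmetric] tendsto_eventually) auto
  qed
  also have "\<dots> \<le> liminf (\<lambda>n. \<integral>\<^sup>+ \<omega>. ennreal (cell_prod z (\<P> n) \<omega>) \<partial>M)"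
    using cell_prod by (intro nn_integral_liminf) auto
  also have "\<dots> \<le> limsup (\<lambda>n. \<integral>\<^sup>+ \<omega>. ennreal (cell_prod z (\<P> n) \<omega>) \<partial>M)"
    by (rule Liminf_le_Limsup) simp
  also have "\<dots> \<le> ennreal (exp (z * intensity B))"
  proof (rule Limsup_bounded)
    have "\<forall>\<^sub>F n in sequentially. expectation (cell_prod z (\<P> n)) \<le> exp (z * intensity B)"
      using assms(2) by (intro eventually_expectation_cell_prod_le[OF assms(1) _ part e]) auto
    then show "\<forall>\<^sub>F n in sequentially.
        (\<integral>\<^sup>+ \<omega>. ennreal (cell_prod z (\<P> n) \<omega>) \<partial>M) \<le> ennreal (exp (z * intensity B))"
      by (rule eventually_mono) (simp add: nn_integral_eq_integral[OF cell_prod] nonneg)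
  qed
  also have "\<dots> < \<infinity>" by simp
  finally show ?thesis
    using assms(2) by (intro integrableI_nonneg) auto
qed

lemma
  fixes z :: real
  assumes "compact B" "-1 < z"
  shows integrable_power_pcount: "integrable M (\<lambda>\<omega>. (1 + z) ^ pcount X B \<omega>)"
    and expectation_power_pcount_le: "expectation (\<lambda>\<omega>. (1 + z) ^ pcount X B \<omega>) \<le> exp (z * intensity B)"
proof -
  have bounded: "bounded B" and [measurable]: "B \<in> sets borel"
    using assms(1) by (auto simp: compact_imp_bounded borel_compact)
  obtain e \<P> where part: "\<And>n. fine_borel_partition B (e n) (\<P> n)" and e: "e \<longlonglongrightarrow> 0"
    using ex_refining_partitions[OF assms(1)] by blast
  have measurable_power: "(\<lambda>\<omega>. (1 + z) ^ pcount X B \<omega>) \<in> borel_measurable M" by measurable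
  have measurable_cell_prod: "cell_prod z (\<P> n) \<in> borel_measurable M" for n
    using integrable_cell_prod[OF bounded part] by (rule borel_measurable_integrable)
  have dominating: "integrable M (\<lambda>\<omega>. (1 + \<bar>z\<bar>) ^ pcount X B \<omega>)"
    using assms(1) by (intro integrable_power_pcount_nonneg) auto
  have limit: "AE \<omega> in M. (\<lambda>n. cell_prod z (\<P> n) \<omega>) \<longlonglongrightarrow> (1 + z) ^ pcount X B \<omega>"
    by (intro AE_I2 tendsto_eventually eventually_cell_prod_eq_power[OF bounded part e])
  have bound: "AE \<omega> in M. norm (cell_prod z (\<P> n) \<omega>) \<le> (1 + \<bar>z\<bar>) ^ pcount X B \<omega>" for n
    using abs_cell_prod_le[OF bounded part] by (intro AE_I2) simp
  show "integrable M (\<lambda>\<omega>. (1 + z) ^ pcount X B \<omega>)"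
    using measurable_power measurable_cell_prod dominating limit bound
    by (rule integrable_dominated_convergence)
  have "(\<lambda>n. expectation (cell_prod z (\<P> n))) \<longlonglongrightarrow> expectation (\<lambda>\<omega>. (1 + z) ^ pcount X B \<omega>)"
    using measurable_power measurable_cell_prod dominating limit bound
    by (rule integral_dominated_convergence)
  then show "expectation (\<lambda>\<omega>. (1 + z) ^ pcount X B \<omega>) \<le> exp (z * intensity B)"
    using eventually_expectation_cell_prod_le[OF assms part e]
    by (rule tendsto_upperbound) simp
qed

lemma expectation_pcount:
  assumes "bounded B" "B \<in> sets borel"
  shows "expectation (\<lambda>\<omega>. real (pcount X B \<omega>)) = intensity B"
proof (cases "B = {}")
  case True
  then show ?thesis by (simp add: pcount_def intensity_def set_lebesgue_integral_def)
next
  case False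
  obtain d where "\<forall>x\<in>B. \<forall>y\<in>B. dist x y \<le> d"
    using assms(1) bounded_two_points by blast
  then have part: "fine_borel_partition B (d + 1) {B}"
    using assms(2) False by (force simp: fine_borel_partition_def partition_on_space)
  interpret cells: product_prob_space cell_measure "{B}"
    by (intro product_prob_spaceI prob_space_cell_measure)
  have "expectation (\<lambda>\<omega>. real (pcount X B \<omega>)) =
      (\<integral>x. measure lborel B * K (x B) (x B) \<partial>PiM {B} cell_measure)"
    using expectation_prod_pcount[OF assms(1) part order_refl] by (simp add: cell_matrix_def)
  also have "\<dots> = (\<integral>y. measure lborel B * K y y \<partial>cell_measure B)"
    by (rule cells.product_integral_singleton) measurable
  finally show ?thesis unfolding integral_cell_diag[OF assms] .
qed

end

section \<open>Bernstein's inequality\<close>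

lemma exp_le_bernstein:
  fixes x :: real
  assumes "\<bar>x\<bar> < 3"
  shows "exp x \<le> 1 + x + x\<^sup>2 / (2 * (1 - \<bar>x\<bar> / 3))"
proof -
  have fact_ge: "2 * 3 ^ n \<le> (fact (n + 2) :: real)" for n
  proof (induction n)
    case (Suc n)
    have "2 * 3 ^ Suc n = 3 * (2 * 3 ^ n :: real)" by simp
    also have "\<dots> \<le> real (n + 3) * fact (n + 2)"
      using Suc by (intro mult_mono) auto
    finally show ?case by (simp add: algebra_simps)
  qed (simp add: fact_numeral)
  have term_bound: "norm (inverse (fact (n + 2)) *\<^sub>R x ^ (n + 2)) \<le> x\<^sup>2 / 2 * (\<bar>x\<bar> / 3) ^ n" for n
  proof -
    have "norm (inverse (fact (n + 2)) *\<^sub>R x ^ (n + 2)) = \<bar>x\<bar> ^ (n + 2) / fact (n + 2)"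
      by (simp add: power_abs divide_inverse abs_mult)
    also have "\<dots> \<le> \<bar>x\<bar> ^ (n + 2) / (2 * 3 ^ n)"
      using fact_ge[of n] by (intro divide_left_mono) auto
    also have "\<dots> = x\<^sup>2 / 2 * (\<bar>x\<bar> / 3) ^ n"
      by (simp only: power_add power2_abs power_divide times_divide_times_eq mult.commute)
    finally show ?thesis .
  qed
  have ratio: "norm (\<bar>x\<bar> / 3) < 1" using assms by simp
  have "norm (\<Sum>n. inverse (fact (n + 2)) *\<^sub>R x ^ (n + 2)) \<le> (\<Sum>n. x\<^sup>2 / 2 * (\<bar>x\<bar> / 3) ^ n)"
    using term_bound by (rule norm_suminf_le) (intro summable_mult summable_geometric ratio)
  also have "\<dots> = x\<^sup>2 / 2 * (1 / (1 - \<bar>x\<bar> / 3))"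
    by (simp only: suminf_mult[OF summable_geometric[OF ratio]] suminf_geometric[OF ratio])
  finally show ?thesis
    unfolding exp_first_two_terms[of x] by simp
qed

text \<open>\<open>\<bar>x\<bar> = \<epsilon>/(1 + \<epsilon>/3)\<close> is the value at which \<open>x\<^sup>2/(2(1 - \<bar>x\<bar>/3))\<close> is half of \<open>\<bar>x\<bar>\<epsilon>\<close>.\<close>

lemma bernstein_exponent:
  fixes x \<epsilon> :: real
  assumes "\<epsilon> > 0" and x: "\<bar>x\<bar> = 3 * \<epsilon> / (3 + \<epsilon>)"
  shows "exp x - 1 - x - \<bar>x\<bar> * \<epsilon> \<le> - (3 * \<epsilon>\<^sup>2 / (6 + 2 * \<epsilon>))"
proof -
  have "x\<^sup>2 / (2 * (1 - \<bar>x\<bar> / 3)) = \<bar>x\<bar> * (\<bar>x\<bar> / (1 - \<bar>x\<bar> / 3)) / 2"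
    by (simp add: power2_eq_square)
  also have "\<bar>x\<bar> / (1 - \<bar>x\<bar> / 3) = \<epsilon>"
    unfolding x using assms(1) by (simp add: field_simps)
  finally have quadratic: "x\<^sup>2 / (2 * (1 - \<bar>x\<bar> / 3)) = \<bar>x\<bar> * \<epsilon> / 2" .
  have "\<bar>x\<bar> < 3" unfolding x using assms(1) by (simp add: field_simps)
  from exp_le_bernstein[OF this] have "exp x - 1 - x - \<bar>x\<bar> * \<epsilon> \<le> - (\<bar>x\<bar> * \<epsilon> / 2)"
    unfolding quadratic by linarith
  also have "\<bar>x\<bar> * \<epsilon> / 2 = 3 * \<epsilon>\<^sup>2 / (6 + 2 * \<epsilon>)"
    unfolding x using assms(1) by (simp add: field_simps power2_eq_square)
  finally show ?thesis .
qed

context contractive_dpp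
begin

lemma chernoff_pcount:
  assumes "compact B"
  shows "prob {\<omega> \<in> space M. t \<le> l * real (pcount X B \<omega>)} \<le> exp ((exp l - 1) * intensity B - t)"
proof -
  have power: "(1 + (exp l - 1)) ^ k = exp (l * real k)" for k
    using exp_of_nat_mult[of k l] by (simp add: mult.commute)
  have z: "-1 < exp l - 1" by simp
  note integrable_exp = integrable_power_pcount[OF assms z, unfolded power]
  have "prob {\<omega> \<in> space M. t \<le> l * real (pcount X B \<omega>)} =
      prob {\<omega> \<in> space M. exp t \<le> exp (l * real (pcount X B \<omega>))}"
    by simp
  also have "\<dots> \<le> expectation (\<lambda>\<omega>. exp (l * real (pcount X B \<omega>))) / exp t"
    using integrable_exp by (intro integral_Markov_inequality_measure[where A = "{}"]) auto
  also have "\<dots> \<le> exp ((exp l - 1) * intensity B) / exp t"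
    using expectation_power_pcount_le[OF assms z, unfolded power] by (intro divide_right_mono) auto
  finally show ?thesis by (simp add: exp_diff)
qed

lemma bernstein_tail:
  assumes "compact B" "\<epsilon> > 0" "intensity B > 0" "\<bar>x\<bar> = 3 * \<epsilon> / (3 + \<epsilon>)"
  shows "prob {\<omega> \<in> space M. x * intensity B + \<bar>x\<bar> * (\<epsilon> * intensity B) \<le> x * real (pcount X B \<omega>)}
    \<le> exp (- (3 * \<epsilon>\<^sup>2 / (6 + 2 * \<epsilon>)) * intensity B)"
    (is "prob ?U \<le> _")
proof -
  have "prob ?U \<le> exp ((exp x - 1) * intensity B - (x * intensity B + \<bar>x\<bar> * (\<epsilon> * intensity B)))"
    by (rule chernoff_pcount[OF assms(1)])
  also have "\<dots> = exp ((exp x - 1 - x - \<bar>x\<bar> * \<epsilon>) * intensity B)"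
    by (simp add: algebra_simps)
  also have "\<dots> \<le> exp (- (3 * \<epsilon>\<^sup>2 / (6 + 2 * \<epsilon>)) * intensity B)"
    unfolding exp_le_cancel_iff using bernstein_exponent[OF assms(2,4)] assms(3)
    by (intro mult_right_mono) auto
  finally show ?thesis .
qed

theorem bernstein_inequality:
  assumes "compact B" "\<epsilon> > 0" "intensity B > 0"
  shows "prob {\<omega> \<in> space M. \<bar>real (pcount X B \<omega>) / intensity B - 1\<bar> \<ge> \<epsilon>}
    \<le> 2 * exp (- (3 * \<epsilon>\<^sup>2 / (6 + 2 * \<epsilon>)) * intensity B)"
proof -
  define n where "n = intensity B"
  define l where "l = 3 * \<epsilon> / (3 + \<epsilon>)"
  have "n > 0" "l > 0" using assms(2,3) by (auto simp: n_def l_def)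
  have [measurable]: "B \<in> sets borel" using assms(1) by (rule borel_compact)
  define U where "U x = {\<omega> \<in> space M. x * n + \<bar>x\<bar> * (\<epsilon> * n) \<le> x * real (pcount X B \<omega>)}" for x
  have U_event: "U x \<in> events" for x
    unfolding U_def by measurable
  have tail: "prob (U x) \<le> exp (- (3 * \<epsilon>\<^sup>2 / (6 + 2 * \<epsilon>)) * n)" if "\<bar>x\<bar> = l" for x
    unfolding U_def n_def using that by (intro bernstein_tail[OF assms]) (simp add: l_def)
  have "{\<omega> \<in> space M. \<bar>real (pcount X B \<omega>) / n - 1\<bar> \<ge> \<epsilon>} \<subseteq> U l \<union> U (- l)"
  proof
    fix \<omega> assume \<omega>: "\<omega> \<in> {\<omega> \<in> space M. \<bar>real (pcount X B \<omega>) / n - 1\<bar> \<ge> \<epsilon>}"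
    let ?N = "real (pcount X B \<omega>)"
    have "?N / n - 1 = (?N - n) / n" using \<open>n > 0\<close> by (simp add: field_simps)
    with \<omega> have "\<epsilon> * n \<le> \<bar>?N - n\<bar>"
      using \<open>n > 0\<close> by (simp add: pos_le_divide_eq)
    then have "\<epsilon> * n \<le> ?N - n \<or> \<epsilon> * n \<le> n - ?N" by linarith
    then have "l * (\<epsilon> * n) \<le> l * (?N - n) \<or> l * (\<epsilon> * n) \<le> l * (n - ?N)"
      using \<open>l > 0\<close> by simp
    then show "\<omega> \<in> U l \<union> U (- l)"
      using \<omega> \<open>l > 0\<close> unfolding U_def right_diff_distrib by auto
  qed
  then have "prob {\<omega> \<in> space M. \<bar>real (pcount X B \<omega>) / n - 1\<bar> \<ge> \<epsilon>} \<le> prob (U l \<union> U (- l))"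
    using U_event by (intro finite_measure_mono) auto
  also have "\<dots> \<le> prob (U l) + prob (U (- l))"
    by (intro measure_Un_le U_event)
  also have "\<dots> \<le> 2 * exp (- (3 * \<epsilon>\<^sup>2 / (6 + 2 * \<epsilon>)) * n)"
    using tail[of l] tail[of "- l"] \<open>l > 0\<close> by simp
  finally show ?thesis by (simp only: n_def)
qed

end

theorem theorem2:
  fixes S :: "real^'n^'n" and M :: "'b measure" and X :: "'b \<Rightarrow> (real^'n) set"
    and R :: real
  assumes "pos_def_matrix S"
    and "(2 * pi) powr (real CARD('n) / 2) * sqrt (det S) = 1"
    and "is_DPP M X (gauss_kernel S)"
    and "R > 0"
  shows "(\<integral>\<omega>. real (pcount X (cball 0 R) \<omega>) \<partial>M) = measure lborel (cball (0::real^'n) R)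
       \<and> measure lborel (cball (0::real^'n) R) = measure lborel (cball (0::real^'n) 1) * R ^ CARD('n)
       \<and> (\<forall>\<epsilon>>0. measure M {\<omega>\<in>space M.
              \<bar>real (pcount X (cball 0 R) \<omega>) / (\<integral>\<omega>. real (pcount X (cball 0 R) \<omega>) \<partial>M) - 1\<bar> \<ge> \<epsilon>}
            \<le> 2 * exp (- (3 * \<epsilon>^2 / (6 + 2 * \<epsilon>)) * measure lborel (cball (0::real^'n) R)))"
proof -
  let ?B = "cball (0::real^'n) R"
  interpret contractive_dpp M X "gauss_kernel S"
    using assms(3) continuous_gauss_kernel psd_on_gauss_kernel[OF assms(1)]
      nn_integral_gauss_kernel[OF assms(1)]
    by unfold_locales (auto simp: gauss_kernel_nonneg[OF assms(1)])
  have "gauss_kernel S x x = 1" for x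
    using assms(2) by (simp add: gauss_kernel_def)
  then have intensity: "intensity ?B = measure lborel ?B"
    by (simp add: intensity_def set_lebesgue_integral_def)
  have volume: "measure lborel ?B = measure lborel (cball (0::real^'n) 1) * R ^ CARD('n)"
    and "measure lborel ?B > 0"
    using assms(4) by (simp_all add: content_cball)
  then show ?thesis
    using bernstein_inequality[OF compact_cball, of _ 0 R] expectation_pcount[OF bounded_cball, of 0 R]
    by (simp add: intensity)
qed

end
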